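(* Let $n\ge 1$ and let $\sigma=(u,v,w)$ be a system of permutations on the edges of the triangle $n\Delta_2$, i.e. a triple of permutations of $[n]$. Then $\sigma$ is the system of permutations of some lozenge tiling of $n\Delta_2$ (with some numbering of its $n$ unit triangles) if and only if $\sigma$ is acyclic.
   Context: Notation: $[n]=\{1,\dots,n\}$. Permutations of $[n]$ are written as words in one-line notation. Triangle and tilings: $n\Delta_2=\{x\in\mathbb R^3: x_1,x_2,x_3\ge 0,\ x_1+x_2+x_3=n\}$ is drawn as an equilateral triangle of side $n$ with top vertex $A=(n,0,0)$, lower left vertex $B=(0,n,0)$ and lower right vertex $C=(0,0,n)$. The lines $x_a\in\mathbb Z$ divide it into unit equilateral triangles pointing upward (those of the form $x+\Delta_2$, with $\Delta_2$ the convex hull of the standard basis vectors and $x$ a vector of non-negative integers with sum $n-1$) and unit triangles pointing downward. A unit rhombus is the union of two of these unit triangles sharing a side. A lozenge tiling of $n\Delta_2$ is a subdivision of $n\Delta_2$ into upward unit triangles and unit rhombi. Every lozenge tiling has exactly $n$ unit triangles. System of permutations of a lozenge tiling: number the $n$ unit triangles of the tiling by $1,\dots,n$. From each of the three sides of triangle $i$, color $i$ spreads away from the triangle: if the side is not on the boundary of $n\Delta_2$, it is a side of a rhombus of the tiling; cross that rhombus to its opposite (parallel) side, and continue in this way until the boundary of $n\Delta_2$ is reached. Starting from the side parallel to an edge $e$ of $n\Delta_2$, one ends at a unit segment of $e$, which receives the number $i$. In this way each of the $n$ unit segments of each edge of $n\Delta_2$ receives exactly one number in $[n]$. Reading these numbers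 clockwise around the triangle starting at the lower left vertex gives three permutations of $[n]$: $u$ (read along the edge from $B$ to $A$), $v$ (from $A$ to $C$) and $w$ (from $C$ to $B$). The triple $(u,v,w)$ is the system of permutations of the numbered tiling. Acyclic: a triple $(u,v,w)$ of permutations of $[n]$ (read clockwise around the triangle starting at the lower left vertex, i.e. $u$ along the edge from $B$ to $A$, $v$ along the edge from $A$ to $C$ and $w$ along the edge from $C$ to $B$) is acyclic if there are no $i\ne j$ in $[n]$ such that $i$ appears before $j$ in all three words $u$, $v$ and $w$. *)

theory Defs
  imports "HOL-Analysis.Analysis" "HOL-Combinatorics.Multiset_Permutations"
begin

text \<open>
  Coordinates are indexed by the type \<open>3\<close>, whose elements are written \<open>1\<close>, \<open>2\<close>, \<open>3\<close>; they
  correspond to the corners \<open>A\<close> (top), \<open>B\<close> (lower left) and \<open>C\<close> (lower right).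
\<close>

definition dilated_simplex :: "nat \<Rightarrow> (real ^ 3) set" where
  "dilated_simplex n = {x. (\<forall>a. 0 \<le> x $ a) \<and> (\<Sum>a\<in>UNIV. x $ a) = real n}"

definition nat_vector :: "nat \<Rightarrow> real ^ 3 \<Rightarrow> bool" where
  "nat_vector m x \<longleftrightarrow> (\<forall>a. x $ a \<in> \<nat>) \<and> (\<Sum>a\<in>UNIV. x $ a) = real m"

definition up_triangle :: "real ^ 3 \<Rightarrow> (real ^ 3) set" where
  "up_triangle x = (+) x ` (convex hull (range (\<lambda>a. axis a 1)))"

definition down_triangle :: "real ^ 3 \<Rightarrow> (real ^ 3) set" where
  "down_triangle y = (+) y ` (convex hull {axis a 1 + axis b 1 | a b. a \<noteq> b})"

text \<open>
  The side labelled \<open>a\<close> of a unit triangle is the one parallel to the edge \<open>x\<^sub>a = 0\<close> of the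
  big triangle. It lies on the line \<open>x\<^sub>a = x $ a\<close> for \<open>up_triangle x\<close> and on the line
  \<open>x\<^sub>a = y $ a + 1\<close> for \<open>down_triangle y\<close>.
\<close>

definition up_side :: "real ^ 3 \<Rightarrow> 3 \<Rightarrow> (real ^ 3) set" where
  "up_side x a = (+) x ` (convex hull {axis b 1 | b. b \<noteq> a})"

definition down_side :: "real ^ 3 \<Rightarrow> 3 \<Rightarrow> (real ^ 3) set" where
  "down_side y a = (+) y ` (convex hull {axis a 1 + axis b 1 | b. b \<noteq> a})"

text \<open>
  The corner parameters of the upward (downward) unit triangles in \<open>dilated_simplex n\<close>
  are the non-negative integer vectors with coordinate sum \<open>n - 1\<close> (\<open>n - 2\<close>); the subtraction
  is avoided by quantifying over the sum.
\<close>

definition up_triangles :: "nat \<Rightarrow> (real ^ 3) set set" where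
  "up_triangles n = {up_triangle x | x m. nat_vector m x \<and> m + 1 = n}"

text \<open>
  \<open>forms_rhombus n x y b\<close>: the unit triangles \<open>up_triangle x\<close> and \<open>down_triangle y\<close> of
  \<open>dilated_simplex n\<close> share their sides labelled \<open>b\<close>. Sides with different labels are not
  parallel, so this is the only way in which two unit triangles can share a side.
\<close>

definition forms_rhombus :: "nat \<Rightarrow> real ^ 3 \<Rightarrow> real ^ 3 \<Rightarrow> 3 \<Rightarrow> bool" where
  "forms_rhombus n x y b \<longleftrightarrow>
     (\<exists>m. nat_vector m x \<and> m + 1 = n) \<and> (\<exists>m. nat_vector m y \<and> m + 2 = n) \<and>
     up_side x b = down_side y b"

definition unit_rhombi :: "nat \<Rightarrow> (real ^ 3) set set" where
  "unit_rhombi n = {up_triangle x \<union> down_triangle y | x y b. forms_rhombus n x y b}"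

definition opposite_sides :: "nat \<Rightarrow> (real ^ 3) set \<Rightarrow> (real ^ 3) set \<Rightarrow> (real ^ 3) set \<Rightarrow> bool" where
  "opposite_sides n R s t \<longleftrightarrow>
     (\<exists>x y a b. forms_rhombus n x y b \<and> R = up_triangle x \<union> down_triangle y \<and> a \<noteq> b \<and>
        {s, t} = {up_side x a, down_side y a})"

definition lozenge_tiling :: "nat \<Rightarrow> (real ^ 3) set set \<Rightarrow> bool" where
  "lozenge_tiling n T \<longleftrightarrow>
     T \<subseteq> up_triangles n \<union> unit_rhombi n \<and>
     \<Union> T = dilated_simplex n \<and>
     pairwise (\<lambda>S S'. disjnt (rel_interior S) (rel_interior S')) T"

definition numbering :: "nat \<Rightarrow> (real ^ 3) set set \<Rightarrow> (nat \<Rightarrow> (real ^ 3) set) \<Rightarrow> bool" where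
  "numbering n T c \<longleftrightarrow> bij_betw c {1..n} (T \<inter> up_triangles n)"

text \<open>
  \<open>spreads n T S t\<close>: the colour of the tile \<open>S\<close> (an upward triangle) reaches the unit segment \<open>t\<close>
  by repeatedly crossing rhombi of \<open>T\<close> to the opposite side. Crossing is a symmetric relation, but
  this adds nothing to the reflexive transitive closure: the only rhombus that contains a segment
  just reached, besides the next one, is the rhombus just crossed.
\<close>

definition spreads :: "nat \<Rightarrow> (real ^ 3) set set \<Rightarrow> (real ^ 3) set \<Rightarrow> (real ^ 3) set \<Rightarrow> bool" where
  "spreads n T S t \<longleftrightarrow>
     (\<exists>x a. S = up_triangle x \<and> (\<lambda>s s'. \<exists>R\<in>T. opposite_sides n R s s')\<^sup>*\<^sup>* (up_side x a) t)"

text \<open>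
  The \<open>k\<close>-th unit segment, counted from \<open>k = 0\<close>, of the edge of \<open>dilated_simplex n\<close> traversed
  from corner \<open>p\<close> to corner \<open>q\<close>.
\<close>

definition edge_segment :: "nat \<Rightarrow> 3 \<Rightarrow> 3 \<Rightarrow> nat \<Rightarrow> (real ^ 3) set" where
  "edge_segment n p q k =
     closed_segment (axis p (real n - real k) + axis q (real k))
                    (axis p (real n - real k - 1) + axis q (real k + 1))"

definition edge_reading ::
  "nat \<Rightarrow> (real ^ 3) set set \<Rightarrow> (nat \<Rightarrow> (real ^ 3) set) \<Rightarrow> 3 \<Rightarrow> 3 \<Rightarrow> nat list \<Rightarrow> bool" where
  "edge_reading n T c p q w \<longleftrightarrow>
     w \<in> permutations_of_set {1..n} \<and> (\<forall>k<n. spreads n T (c (w ! k)) (edge_segment n p q k))"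

definition system_of_permutations ::
  "nat \<Rightarrow> (real ^ 3) set set \<Rightarrow> (nat \<Rightarrow> (real ^ 3) set) \<Rightarrow> nat list \<Rightarrow> nat list \<Rightarrow> nat list \<Rightarrow> bool" where
  "system_of_permutations n T c u v w \<longleftrightarrow>
     edge_reading n T c 2 1 u \<and> edge_reading n T c 1 3 v \<and> edge_reading n T c 3 2 w"

definition appears_before :: "'a list \<Rightarrow> 'a \<Rightarrow> 'a \<Rightarrow> bool" where
  "appears_before w i j \<longleftrightarrow> (\<exists>p q. p < q \<and> q < length w \<and> w ! p = i \<and> w ! q = j)"

definition acyclic_system :: "nat \<Rightarrow> nat list \<Rightarrow> nat list \<Rightarrow> nat list \<Rightarrow> bool" where
  "acyclic_system n u v w \<longleftrightarrow>
     \<not> (\<exists>i\<in>{1..n}. \<exists>j\<in>{1..n}. i \<noteq> j \<and>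
          appears_before u i j \<and> appears_before v i j \<and> appears_before w i j)"

end

theory Submission imports Defs begin

text \<open>
A unit triangle is given by a lattice point: a downward triangle \<open>y\<close> has the three upward neighbours
\<open>y + e b\<close>, so a rhombus amounts to a pair of \<open>y\<close> and a label \<open>b\<close>. A tiling is a set of tiles that uses every
unit triangle exactly once (\<open>lozenge_tiling_iff\<close>). Each unit segment is the side labelled \<open>a\<close> of one upward triangle \<open>z\<close>, and crossing
the rhombus of \<open>y\<close> in the direction \<open>a\<close> leads from \<open>z = y + e a\<close> to \<open>z = y + e b\<close>: coordinate \<open>a\<close>
drops by one, one of the other two coordinates grows by one.

\<^emph>\<open>Tilings give acyclic systems.\<close> Two rays with the same label never meet, since each
upward triangle is part of at most one rhombus, so they keep their order. If the triangles \<open>x\<close> and \<open>x'\<close> of two colours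
satisfy \<open>x' $ a \<le> x $ a\<close> and \<open>x' $ b \<le> x $ b\<close>, this determines in which order they arrive on the edges
\<open>a\<close> and \<open>b\<close>, and the two orders disagree when the edges are read clockwise. Among three coordinates, two
always compare in the same way, up to exchanging \<open>x\<close> and \<open>x'\<close>. Hence no pair of colours is in the same order
on all three edges (\<open>not_all_ordered\<close>).

\<^emph>\<open>Acyclic systems come from tilings.\<close> A lattice path from \<open>B\<close> to \<open>A\<close> is swept across the triangle, from the
edge \<open>BA\<close> to the path \<open>BCA\<close> along the other two edges. The path is a word of unit segments, each with a
label and a colour, and it advances over one tile at a time: a unit triangle of colour \<open>i\<close> replaces
\<open>3\<^sub>i\<close> by \<open>1\<^sub>i 2\<^sub>i\<close>, a rhombus exchanges two neighbouring letters, moving a \<open>1\<close> to the left or a \<open>2\<close> to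
the right. The initial word has the letters \<open>3\<close> in the order \<open>u\<close>; the final word has to be the letters \<open>1\<close>
in the order \<open>rev w\<close>, followed by the letters \<open>2\<close> in the order \<open>rev v\<close>. Let \<open>i\<close> be before \<open>j\<close> in \<open>u\<close>.
For \<open>1\<^sub>j\<close> to get before \<open>1\<^sub>i\<close>, colour \<open>j\<close> has to be split first; for \<open>2\<^sub>j\<close> to get before \<open>2\<^sub>i\<close>,
colour \<open>i\<close> has to be split first; acyclicity says that not both are required. Splitting the colours in
the order \<open>rev w\<close> is therefore always right, and \<open>sweep_sorting\<close> carries this out.

The tiles met by the sweep form a tiling because the path is, with signs, the boundary of what has been
swept (\<open>balanced\<close>). For the final path this forces every unit triangle to have been swept exactly once
(\<open>swept_once\<close>). The colours reach the right segments because every move prolongs the rays of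
the colours that it touches (\<open>coloured\<close>).
\<close>

section \<open>Unit triangles and their sides\<close>

definition up_cell :: "nat \<Rightarrow> real ^ 3 \<Rightarrow> bool" where
  "up_cell n x \<longleftrightarrow> (\<exists>m. nat_vector m x \<and> m + 1 = n)"

definition down_cell :: "nat \<Rightarrow> real ^ 3 \<Rightarrow> bool" where
  "down_cell n y \<longleftrightarrow> (\<exists>m. nat_vector m y \<and> m + 2 = n)"

abbreviation e :: "3 \<Rightarrow> real ^ 3" where "e a \<equiv> axis a 1"

lemma axis_component: "axis a r $ b = (if b = a then r else 0)"
  by (simp add: axis_def)

lemma nats_iff: "r \<in> \<nat> \<longleftrightarrow> r \<in> \<int> \<and> 0 \<le> r" for r :: real
  using Nats_altdef2 by blast

lemma eq_of_nat_minus_iff: "(\<exists>m. s = real m \<and> m + k = n) \<longleftrightarrow> s = real n - real k \<and> 0 \<le> s"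
  by (auto simp: of_nat_diff intro!: exI[of _ "n - k"])

lemma up_cell_iff:
  "up_cell n x \<longleftrightarrow> (\<forall>a. x $ a \<in> \<int> \<and> 0 \<le> x $ a) \<and> (\<Sum>a\<in>UNIV. x $ a) = real n - 1"
  using eq_of_nat_minus_iff[of "\<Sum>a\<in>UNIV. x $ a" 1 n] sum_nonneg[of UNIV "\<lambda>a. x $ a"]
  unfolding up_cell_def nat_vector_def nats_iff by auto

lemma down_cell_iff:
  "down_cell n x \<longleftrightarrow> (\<forall>a. x $ a \<in> \<int> \<and> 0 \<le> x $ a) \<and> (\<Sum>a\<in>UNIV. x $ a) = real n - 2"
  using eq_of_nat_minus_iff[of "\<Sum>a\<in>UNIV. x $ a" 2 n] sum_nonneg[of UNIV "\<lambda>a. x $ a"]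
  unfolding down_cell_def nat_vector_def nats_iff by auto

lemma up_triangle_eq:
  "up_triangle x = {z. (\<Sum>a\<in>UNIV. z $ a) = (\<Sum>a\<in>UNIV. x $ a) + 1 \<and> (\<forall>a. x $ a \<le> z $ a)}"
proof -
  have hull: "convex hull (range (\<lambda>a. e a)) = {u *\<^sub>R e 1 + v *\<^sub>R e 2 + w *\<^sub>R e 3 | u v w.
      0 \<le> u \<and> 0 \<le> v \<and> 0 \<le> w \<and> u + v + w = 1}"
    by (simp add: UNIV_3 convex_hull_3)
  show ?thesis
  proof (intro subset_antisym subsetI)
    fix z assume "z \<in> up_triangle x"
    then show "z \<in> {z. (\<Sum>a\<in>UNIV. z $ a) = (\<Sum>a\<in>UNIV. x $ a) + 1 \<and> (\<forall>a. x $ a \<le> z $ a)}"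
      unfolding up_triangle_def hull by (auto simp: sum_3 axis_component forall_3)
  next
    fix z assume z: "z \<in> {z. (\<Sum>a\<in>UNIV. z $ a) = (\<Sum>a\<in>UNIV. x $ a) + 1 \<and> (\<forall>a. x $ a \<le> z $ a)}"
    have "z = x + ((z$1 - x$1) *\<^sub>R e 1 + (z$2 - x$2) *\<^sub>R e 2 + (z$3 - x$3) *\<^sub>R e 3)"
      by (simp add: vec_eq_iff forall_3 axis_component)
    moreover have "(z$1 - x$1) *\<^sub>R e 1 + (z$2 - x$2) *\<^sub>R e 2 + (z$3 - x$3) *\<^sub>R e 3 
       \<in> convex hull (range (\<lambda>a. e a))"
      unfolding hull
    proof (intro CollectI exI conjI)
      show "0 \<le> z$1 - x$1" "0 \<le> z$2 - x$2" "0 \<le> z$3 - x$3" using z by simp_all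
      show "z$1 - x$1 + (z$2 - x$2) + (z$3 - x$3) = 1" using z unfolding mem_Collect_eq sum_3 by linarith
    qed (rule refl)
    ultimately show "z \<in> up_triangle x"
      unfolding up_triangle_def by (rule image_eqI)
  qed
qed

lemma down_triangle_eq:
  "down_triangle y = {z. (\<Sum>a\<in>UNIV. z $ a) = (\<Sum>a\<in>UNIV. y $ a) + 2 \<and> (\<forall>a. z $ a \<le> y $ a + 1)}"
proof -
  have "{e a + e b | a b. a \<noteq> b} = {e 2 + e 3, e 1 + e 3, e 1 + e 2}"
  proof (intro subset_antisym subsetI)
    fix z assume "z \<in> {e a + e b | a b. a \<noteq> b}"
    then obtain a b where "a \<noteq> b" "z = e a + e b" by blast
    then show "z \<in> {e 2 + e 3, e 1 + e 3, e 1 + e 2}"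
      using exhaust_3[of a] exhaust_3[of b] by (auto simp: add.commute)
  next
    fix z :: "real^3" assume "z \<in> {e 2 + e 3, e 1 + e 3, e 1 + e 2}"
    moreover have "(2::3) \<noteq> 3" "(1::3) \<noteq> 3" "(1::3) \<noteq> 2" by simp_all
    ultimately show "z \<in> {e a + e b | a b. a \<noteq> b}" by blast
  qed
  then have hull: "convex hull {e a + e b | a b. a \<noteq> b} =
      {u *\<^sub>R (e 2 + e 3) + v *\<^sub>R (e 1 + e 3) + w *\<^sub>R (e 1 + e 2) | u v w.
      0 \<le> u \<and> 0 \<le> v \<and> 0 \<le> w \<and> u + v + w = 1}"
    by (simp add: convex_hull_3)
  show ?thesis
  proof (intro subset_antisym subsetI)
    fix z assume "z \<in> down_triangle y"
    then show "z \<in> {z. (\<Sum>a\<in>UNIV. z $ a) = (\<Sum>a\<in>UNIV. y $ a) + 2 \<and> (\<forall>a. z $ a \<le> y $ a + 1)}"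
      unfolding down_triangle_def hull by (auto simp: sum_3 axis_component forall_3)
  next
    fix z assume z: "z \<in> {z. (\<Sum>a\<in>UNIV. z $ a) = (\<Sum>a\<in>UNIV. y $ a) + 2 \<and> (\<forall>a. z $ a \<le> y $ a + 1)}"
    define t where "t = (\<lambda>a. y $ a + 1 - z $ a)"
    have "z = y + (t 1 *\<^sub>R (e 2 + e 3) + t 2 *\<^sub>R (e 1 + e 3) + t 3 *\<^sub>R (e 1 + e 2))"
    proof -
      have "z$1 + z$2 + z$3 = y$1 + y$2 + y$3 + 2" using z unfolding mem_Collect_eq sum_3 by linarith
      then have "z$1 = y$1 + (t 2 + t 3)" "z$2 = y$2 + (t 1 + t 3)" "z$3 = y$3 + (t 1 + t 2)"
        unfolding t_def by linarith+
      then show ?thesis by (simp add: vec_eq_iff forall_3 axis_component)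
    qed
    moreover have "t 1 *\<^sub>R (e 2 + e 3) + t 2 *\<^sub>R (e 1 + e 3) + t 3 *\<^sub>R (e 1 + e 2)
       \<in> convex hull {e a + e b | a b. a \<noteq> b}"
      unfolding hull
    proof (intro CollectI exI conjI)
      show "0 \<le> t 1" "0 \<le> t 2" "0 \<le> t 3" using z by (simp_all add: t_def)
      show "t 1 + t 2 + t 3 = 1" using z unfolding t_def mem_Collect_eq sum_3 by linarith
    qed (rule refl)
    ultimately show "z \<in> down_triangle y"
      unfolding down_triangle_def by (rule image_eqI)
  qed
qed

lemma two_other_labels: "\<exists>c d. {b. b \<noteq> a} = {c, d} \<and> c \<noteq> d" for a :: 3
proof -
  consider "a = 1" | "a = 2" | "a = 3" using exhaust_3 by blast
  then show ?thesis
  proof cases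
    case 1 then show ?thesis by (intro exI[of _ 2] exI[of _ 3]) (use exhaust_3 in auto)
  next
    case 2 then show ?thesis by (intro exI[of _ 1] exI[of _ 3]) (use exhaust_3 in auto)
  next
    case 3 then show ?thesis by (intro exI[of _ 1] exI[of _ 2]) (use exhaust_3 in auto)
  qed
qed

lemma up_side_eq_segment:
  assumes "{b. b \<noteq> a} = {c, d}"
  shows "up_side x a = closed_segment (x + e c) (x + e d)"
proof -
  have "{e b | b. b \<noteq> a} = e ` {b. b \<noteq> a}" by auto
  then have "{e b | b. b \<noteq> a} = {e c, e d}" unfolding assms by simp
  then have "up_side x a = (+) x ` closed_segment (e c) (e d)"
    by (simp add: up_side_def segment_convex_hull)
  then show ?thesis by (simp only: closed_segment_translation)
qed

text \<open>
Both sides of a rhombus with label \<open>a\<close> become sides of upward triangles, so that every unit segment has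
one name, a lattice point together with a label.
\<close>

lemma down_side_eq_up_side: "down_side y a = up_side (y + e a) a"
proof -
  have "{e a + e b | b. b \<noteq> a} = (+) (e a) ` {e b | b. b \<noteq> a}" by auto
  then show ?thesis
    unfolding down_side_def up_side_def
    by (simp add: image_image add.assoc convex_hull_translation)
qed

lemma up_side_bounds:
  assumes "z \<in> up_side x a" shows "z $ a = x $ a" "x $ b \<le> z $ b"
proof -
  obtain c d where cd: "{b. b \<noteq> a} = {c, d}" using two_other_labels by blast
  have "c \<in> {b. b \<noteq> a}" "d \<in> {b. b \<noteq> a}" unfolding cd by simp_all
  then have "a \<noteq> c" "a \<noteq> d" by simp_all
  obtain u where "0 \<le> u" "u \<le> 1" "z = (1 - u) *\<^sub>R (x + e c) + u *\<^sub>R (x + e d)"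
    using assms unfolding up_side_eq_segment[OF cd] closed_segment_def by auto
  then have z: "z = x + (1 - u) *\<^sub>R e c + u *\<^sub>R e d" by (simp add: algebra_simps)
  show "z $ a = x $ a" unfolding z using \<open>a \<noteq> c\<close> \<open>a \<noteq> d\<close> by (simp add: axis_component)
  show "x $ b \<le> z $ b" unfolding z using \<open>0 \<le> u\<close> \<open>u \<le> 1\<close> by (simp add: axis_component)
qed

lemma corner_in_up_side: "b \<noteq> a \<Longrightarrow> x + e b \<in> up_side x a"
  unfolding up_side_def by (blast intro: hull_inc)

lemma third_label: "\<exists>c. c \<noteq> a \<and> c \<noteq> b" for a b :: 3
proof -
  have "card {a, b} < CARD(3)" using card_insert_le_m1[of 2 "{b}" a] by simp
  then have "{a, b} \<noteq> UNIV" by (metis less_irrefl)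
  then show ?thesis by blast
qed

lemma up_side_le:
  assumes "up_side x a = up_side x' a'" shows "x' $ b \<le> x $ b"
proof -
  obtain c where "c \<noteq> a" "c \<noteq> b"
    using third_label by blast
  then have "x + e c \<in> up_side x' a'" using assms corner_in_up_side by blast
  from up_side_bounds(2)[OF this, of b] show ?thesis using \<open>c \<noteq> b\<close> by (simp add: axis_component)
qed

lemma up_side_inject: "up_side x a = up_side x' a' \<longleftrightarrow> x = x' \<and> a = a'"
proof
  assume eq: "up_side x a = up_side x' a'"
  have "x $ b = x' $ b" for b
    using up_side_le[OF eq] up_side_le[OF eq[symmetric]] by (rule antisym[rotated])
  then have "x = x'" by (simp add: vec_eq_iff)
  moreover have "a = a'"
  proof (rule ccontr)
    assume "a \<noteq> a'"
    then have "x + e a' \<in> up_side x' a'" using eq corner_in_up_side by metis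
    from up_side_bounds(1)[OF this] show False using \<open>x = x'\<close> by (simp add: axis_component)
  qed
  ultimately show "x = x' \<and> a = a'" ..
qed simp

lemma up_cell_above_down_cell: "down_cell n y \<Longrightarrow> up_cell n (y + e b)"
  by (auto simp: up_cell_iff down_cell_iff sum.distrib axis_component)

lemma forms_rhombus_iff: "forms_rhombus n x y b \<longleftrightarrow> down_cell n y \<and> x = y + e b"
  using up_cell_above_down_cell[of n y b]
  unfolding forms_rhombus_def down_side_eq_up_side up_side_inject
  unfolding up_cell_def[symmetric] down_cell_def[symmetric] by auto

section \<open>Tilings as exact covers by unit triangles\<close>

definition plane :: "nat \<Rightarrow> (real ^ 3) set" where
  "plane n = {z. (\<Sum>a\<in>UNIV. z $ a) = real n}"

definition unit_triangle :: "nat \<Rightarrow> (real ^ 3) set \<Rightarrow> bool" where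
  "unit_triangle n U \<longleftrightarrow>
     (\<exists>x. up_cell n x \<and> U = up_triangle x) \<or> (\<exists>y. down_cell n y \<and> U = down_triangle y)"

text \<open>
A generic point lies on no grid line, so rounding its coordinates down tells which unit triangle it is in.
Such points replace the topology of tiles by arithmetic.
\<close>

definition generic :: "real ^ 3 \<Rightarrow> bool" where
  "generic z \<longleftrightarrow> (\<forall>a. z $ a \<notin> \<int>)"

lemma up_triangle_in_simplex: "up_cell n x \<Longrightarrow> up_triangle x \<subseteq> dilated_simplex n"
  unfolding up_triangle_eq up_cell_iff dilated_simplex_def by (auto intro: order_trans)

lemma down_triangle_in_simplex:
  assumes "down_cell n y" shows "down_triangle y \<subseteq> dilated_simplex n"
proof
  fix z assume "z \<in> down_triangle y"
  then have sum: "z$1 + z$2 + z$3 = y$1 + y$2 + y$3 + 2" and le: "\<And>a. z $ a \<le> y $ a + 1"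
    unfolding down_triangle_eq sum_3 by auto
  have y: "\<And>a. 0 \<le> y $ a" "y$1 + y$2 + y$3 = real n - 2"
    using assms unfolding down_cell_iff sum_3 by auto
  have "0 \<le> z $ 1" "0 \<le> z $ 2" "0 \<le> z $ 3"
    using sum le[of 1] le[of 2] le[of 3] y(1)[of 1] y(1)[of 2] y(1)[of 3] by linarith+
  moreover have "z$1 + z$2 + z$3 = real n" using sum y(2) by linarith
  ultimately show "z \<in> dilated_simplex n"
    unfolding dilated_simplex_def sum_3 forall_3 mem_Collect_eq by blast
qed

lemma simplex_in_plane: "dilated_simplex n \<subseteq> plane n"
  unfolding dilated_simplex_def plane_def by blast

lemma unit_triangle_in_simplex: "unit_triangle n U \<Longrightarrow> U \<subseteq> dilated_simplex n"
  unfolding unit_triangle_def using up_triangle_in_simplex down_triangle_in_simplex by blast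

lemma component_le_plus_one:
  fixes x z :: "real^3"
  assumes "\<And>a. x $ a \<le> z $ a" "(\<Sum>a\<in>UNIV. z $ a) = (\<Sum>a\<in>UNIV. x $ a) + 1"
  shows "z $ a \<le> x $ a + 1"
proof -
  have "z $ a - x $ a \<le> (\<Sum>a\<in>UNIV. z $ a - x $ a)"
    by (rule member_le_sum) (use assms(1) in auto)
  then show ?thesis using assms(2) by (simp only: sum_subtractf)
qed

lemma generic_floor:
  assumes "x $ a \<in> \<int>" "x $ a \<le> z $ a" "z $ a \<le> x $ a + 1" "generic z"
  shows "x $ a = of_int \<lfloor>z $ a\<rfloor>"
proof -
  obtain k where k: "x $ a = of_int k" using assms(1) by (auto elim: Ints_cases)
  have "z $ a \<noteq> of_int (k + 1)" using assms(4) unfolding generic_def by (metis Ints_of_int)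
  then have "\<lfloor>z $ a\<rfloor> = k" using assms(2,3) unfolding k by (intro floor_unique) auto
  then show ?thesis using k by simp
qed

lemma up_triangle_generic:
  assumes "up_cell n x" "z \<in> up_triangle x" "generic z"
  shows "x = (\<chi> a. of_int \<lfloor>z $ a\<rfloor>)"
proof -
  have "x $ a = of_int \<lfloor>z $ a\<rfloor>" for a
  proof (rule generic_floor)
    show "x $ a \<in> \<int>" using assms(1) unfolding up_cell_iff by blast
    show "x $ a \<le> z $ a" using assms(2) unfolding up_triangle_eq by blast
    show "z $ a \<le> x $ a + 1"
      by (rule component_le_plus_one) (use assms(2) in \<open>auto simp: up_triangle_eq\<close>)
  qed fact
  then show ?thesis by (simp add: vec_eq_iff)
qed

lemma down_triangle_generic:
  assumes "down_cell n y" "z \<in> down_triangle y" "generic z"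
  shows "y = (\<chi> a. of_int \<lfloor>z $ a\<rfloor>)"
proof -
  have "y $ a = of_int \<lfloor>z $ a\<rfloor>" for a
  proof (rule generic_floor)
    show "y $ a \<in> \<int>" using assms(1) unfolding down_cell_iff by blast
    show "z $ a \<le> y $ a + 1" using assms(2) unfolding down_triangle_eq by blast
    have sum: "(\<Sum>a\<in>UNIV. z $ a) = (\<Sum>a\<in>UNIV. y $ a) + 2" and le: "\<And>a. z $ a \<le> y $ a + 1"
      using assms(2) unfolding down_triangle_eq by auto
    have "(\<Sum>a\<in>UNIV. (y + (\<chi> a. 1)) $ a) = (\<Sum>a\<in>UNIV. z $ a) + 1"
      unfolding sum by (simp add: sum.distrib)
    then have "(y + (\<chi> a. 1)) $ a \<le> z $ a + 1"
      by (intro component_le_plus_one) (use le in auto)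
    then show "y $ a \<le> z $ a" by simp
  qed fact
  then show ?thesis by (simp add: vec_eq_iff)
qed

lemma unit_triangle_generic_unique:
  assumes "unit_triangle n U" "unit_triangle n U'" "z \<in> U" "z \<in> U'" "generic z"
  shows "U = U'"
proof -
  have "\<not> (up_cell n x \<and> down_cell n y \<and> z \<in> up_triangle x \<and> z \<in> down_triangle y)" for x y
  proof
    assume *: "up_cell n x \<and> down_cell n y \<and> z \<in> up_triangle x \<and> z \<in> down_triangle y"
    then have "x = y" using up_triangle_generic down_triangle_generic \<open>generic z\<close> by metis
    then show False using * unfolding up_cell_iff down_cell_iff by auto
  qed
  moreover have "x = x'" if "up_cell n x" "up_cell n x'" "z \<in> up_triangle x" "z \<in> up_triangle x'" for x x'
    using up_triangle_generic \<open>generic z\<close> that by metis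
  moreover have "x = x'" if "down_cell n x" "down_cell n x'" "z \<in> down_triangle x" "z \<in> down_triangle x'" for x x'
    using down_triangle_generic \<open>generic z\<close> that by metis
  ultimately show ?thesis
    using assms(1-4) unfolding unit_triangle_def by metis
qed

lemma third_not_int: "r \<in> \<int> \<Longrightarrow> r + 1 / 3 \<notin> \<int>" "r \<in> \<int> \<Longrightarrow> r + 2 / 3 \<notin> \<int>" for r :: real
proof -
  have no: "(1 / 3 :: real) \<notin> \<int>" "(2 / 3 :: real) \<notin> \<int>"
    by (auto elim!: Ints_cases simp: field_simps)
  show "r \<in> \<int> \<Longrightarrow> r + 1 / 3 \<notin> \<int>" "r \<in> \<int> \<Longrightarrow> r + 2 / 3 \<notin> \<int>"
    using no by (metis Ints_diff add_diff_cancel_left')+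
qed

text \<open>
The barycentre is generic, and its distance from each side is large enough for a ball of radius one third.
\<close>

lemma unit_triangle_centre:
  assumes "unit_triangle n U"
  shows "\<exists>z. generic z \<and> z \<in> U \<and> ball z (1 / 3) \<inter> plane n \<subseteq> U"
proof -
  have near: "\<bar>w $ a - z $ a\<bar> < 1 / 3" if "w \<in> ball z (1 / 3)" for w z :: "real^3" and a
    using that component_le_norm_cart[of "w - z" a] by (simp add: dist_norm norm_minus_commute)
  from assms consider x where "up_cell n x" "U = up_triangle x" | y where "down_cell n y" "U = down_triangle y"
    unfolding unit_triangle_def by blast
  then show ?thesis
  proof cases
    case 1
    let ?z = "x + (\<chi> a. 1 / 3)"
    have "generic ?z"
      using 1(1) third_not_int unfolding generic_def up_cell_iff by simp
    moreover have "?z \<in> U"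
      unfolding 1(2) up_triangle_eq by (simp add: sum_3)
    moreover have "w \<in> U" if w: "w \<in> ball ?z (1 / 3)" "w \<in> plane n" for w
    proof -
      have "x $ a \<le> w $ a" for a using near[OF w(1), of a] unfolding vector_add_component vec_lambda_beta by linarith
      then show ?thesis using w(2) 1(1) unfolding 1(2) up_triangle_eq up_cell_iff plane_def by simp
    qed
    ultimately show ?thesis by blast
  next
    case 2
    let ?z = "y + (\<chi> a. 2 / 3)"
    have "generic ?z"
      using 2(1) third_not_int unfolding generic_def down_cell_iff by simp
    moreover have "?z \<in> U"
      unfolding 2(2) down_triangle_eq by (simp add: sum_3)
    moreover have "w \<in> U" if w: "w \<in> ball ?z (1 / 3)" "w \<in> plane n" for w
    proof -
      have "w $ a \<le> y $ a + 1" for a using near[OF w(1), of a] unfolding vector_add_component vec_lambda_beta by linarith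
      then show ?thesis using w(2) 2(1) unfolding 2(2) down_triangle_eq down_cell_iff plane_def by simp
    qed
    ultimately show ?thesis by blast
  qed
qed

lemma affine_plane: "affine (plane n)"
  unfolding affine_def plane_def
  by (auto simp: sum.distrib simp flip: sum_distrib_left distrib_right)

lemma centre_in_rel_interior:
  assumes "z \<in> U" "ball z (1 / 3) \<inter> plane n \<subseteq> U" "U \<subseteq> S" "S \<subseteq> plane n"
  shows "z \<in> rel_interior S"
proof -
  have "affine hull S \<subseteq> plane n" using assms(4) affine_plane by (rule hull_minimal)
  then show ?thesis using assms unfolding mem_rel_interior_ball
    by (intro conjI exI[of _ "1/3"]) auto
qed

lemma plane_in_affine_hull:
  assumes "up_cell n x" "up_triangle x \<subseteq> S"
  shows "plane n \<subseteq> affine hull S"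
proof
  fix z assume z: "z \<in> plane n"
  have sum: "(\<Sum>a\<in>UNIV. z $ a - x $ a) = 1"
    using z assms(1) unfolding plane_def up_cell_iff by (simp add: sum_subtractf)
  define t where "t = (\<lambda>a. z $ a - x $ a)"
  have corners: "{x + e 1, x + e 2, x + e 3} \<subseteq> S"
    using assms(2) unfolding up_triangle_eq by (auto simp: sum.distrib axis_component)
  have t: "t 1 + t 2 + t 3 = 1" using sum unfolding sum_3 t_def .
  have "z = (t 1 + t 2 + t 3) *\<^sub>R x + t 1 *\<^sub>R e 1 + t 2 *\<^sub>R e 2 + t 3 *\<^sub>R e 3"
    unfolding t by (simp add: vec_eq_iff forall_3 axis_component t_def)
  also have "\<dots> = t 1 *\<^sub>R (x + e 1) + t 2 *\<^sub>R (x + e 2) + t 3 *\<^sub>R (x + e 3)"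
    by (simp add: algebra_simps)
  also have "\<dots> \<in> affine hull {x + e 1, x + e 2, x + e 3}"
    unfolding affine_hull_3 using t by blast
  also have "\<dots> \<subseteq> affine hull S" using corners by (rule hull_mono)
  finally show "z \<in> affine hull S" .
qed

lemma not_int_nearby: "\<exists>\<delta>>0. \<forall>s. 0 < \<bar>s\<bar> \<and> \<bar>s\<bar> < \<delta> \<longrightarrow> r + s \<notin> \<int>" for r :: real
proof (cases "r \<in> \<int>")
  case True
  have "r + s \<notin> \<int>" if "0 < \<bar>s\<bar>" "\<bar>s\<bar> < 1" for s
  proof
    assume "r + s \<in> \<int>"
    then have "s \<in> \<int>" using True by (metis Ints_diff add_diff_cancel_left')
    then show False using that Ints_nonzero_abs_ge1[of s] by simp
  qed
  then show ?thesis by (intro exI[of _ 1]) simp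
next
  case False
  define \<delta> where "\<delta> = min (r - of_int \<lfloor>r\<rfloor>) (of_int \<lfloor>r\<rfloor> + 1 - r)"
  have "of_int \<lfloor>r\<rfloor> \<noteq> r" using False by (metis Ints_of_int)
  then have "\<delta> > 0" unfolding \<delta>_def by (simp add: order.not_eq_order_implies_strict)
  moreover have "r + s \<notin> \<int>" if "\<bar>s\<bar> < \<delta>" for s
  proof
    assume "r + s \<in> \<int>"
    then obtain k where k: "r + s = of_int k" by (auto elim: Ints_cases)
    have "of_int \<lfloor>r\<rfloor> < r + s" "r + s < of_int \<lfloor>r\<rfloor> + 1"
      using that unfolding \<delta>_def by linarith+
    then have "(of_int \<lfloor>r\<rfloor> :: real) < of_int k" "(of_int k :: real) < of_int (\<lfloor>r\<rfloor> + 1)"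
      unfolding k by simp_all
    then show False unfolding of_int_less_iff by linarith
  qed
  ultimately show ?thesis by blast
qed

text \<open>
Relative interiors of tiles are open in the plane of the triangle, so two that meet do so in more than one
point, and all points of a short segment in the direction \<open>e 1 + e 2 - 2 e 3\<close> except its start are generic.
\<close>

lemma generic_common_point:
  assumes z: "z \<in> rel_interior S" "z \<in> rel_interior S'" "z \<in> plane n"
    and hull: "plane n \<subseteq> affine hull S" "plane n \<subseteq> affine hull S'"
  shows "\<exists>z'. generic z' \<and> z' \<in> S \<and> z' \<in> S'"
proof -
  obtain \<epsilon> where \<epsilon>: "\<epsilon> > 0" "ball z \<epsilon> \<inter> affine hull S \<subseteq> S"
    using z(1) unfolding mem_rel_interior_ball by blast
  obtain \<epsilon>' where \<epsilon>': "\<epsilon>' > 0" "ball z \<epsilon>' \<inter> affine hull S' \<subseteq> S'"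
    using z(2) unfolding mem_rel_interior_ball by blast
  have "\<forall>a. \<exists>\<delta>>0. \<forall>s. 0 < \<bar>s\<bar> \<and> \<bar>s\<bar> < \<delta> \<longrightarrow> z $ a + s \<notin> \<int>"
    using not_int_nearby by blast
  then obtain \<delta> where \<delta>: "\<And>a. \<delta> a > 0" "\<And>a s. 0 < \<bar>s\<bar> \<Longrightarrow> \<bar>s\<bar> < \<delta> a \<Longrightarrow> z $ a + s \<notin> \<int>"
    by metis
  \<comment> \<open>Moving by \<open>(t, t, - 2 t)\<close> changes each coordinate by at most \<open>2 t\<close> and the position by at most \<open>4 t\<close>.\<close>
  define t where "t = Min {\<epsilon>, \<epsilon>', \<delta> 1, \<delta> 2, \<delta> 3} / 5"
  have t: "0 < t" "5 * t \<le> \<epsilon>" "5 * t \<le> \<epsilon>'" "5 * t \<le> \<delta> 1" "5 * t \<le> \<delta> 2" "5 * t \<le> \<delta> 3"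
    using \<epsilon>(1) \<epsilon>'(1) \<delta>(1) unfolding t_def by (simp_all add: min_def)
  define z' where "z' = z + t *\<^sub>R (e 1 + e 2 - 2 *\<^sub>R e 3)"
  have comp: "z' $ 1 = z $ 1 + t" "z' $ 2 = z $ 2 + t" "z' $ 3 = z $ 3 + - (2 * t)"
    unfolding z'_def by (simp_all add: axis_component)
  have "z' $ 1 \<notin> \<int>" "z' $ 2 \<notin> \<int>" "z' $ 3 \<notin> \<int>"
    unfolding comp using t by (intro \<delta>(2); simp)+
  then have "generic z'" unfolding generic_def forall_3 by blast
  moreover have "z' \<in> plane n"
    using z(3) unfolding plane_def mem_Collect_eq sum_3 comp by linarith
  moreover have "dist z z' \<le> 4 * t"
  proof -
    have "norm (z' - z) \<le> (\<Sum>a\<in>UNIV. \<bar>(z' - z) $ a\<bar>)" by (rule norm_le_l1_cart)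
    also have "\<dots> = 4 * t" using t(1) unfolding sum_3 vector_minus_component comp by simp
    finally show ?thesis by (simp add: dist_norm norm_minus_commute)
  qed
  ultimately have "generic z' \<and> z' \<in> S \<and> z' \<in> S'"
    using \<epsilon>(2) \<epsilon>'(2) hull t by force
  then show ?thesis by blast
qed

text \<open>
The fractional parts of the three coordinates add up to 0, 1 or 2: the point is a vertex of the grid, or it
lies in the upward or in the downward triangle whose lattice point is obtained by rounding down.
\<close>

lemma simplex_covered:
  assumes "n \<ge> 1" "z \<in> dilated_simplex n"
  shows "\<exists>U. unit_triangle n U \<and> z \<in> U"
proof -
  have z: "\<And>a. 0 \<le> z $ a" "z$1 + z$2 + z$3 = real n"
    using assms(2) unfolding dilated_simplex_def sum_3 by auto
  define x :: "real^3" where "x = (\<chi> a. of_int \<lfloor>z $ a\<rfloor>)"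
  have x: "x $ a \<in> \<int>" "0 \<le> x $ a" "x $ a \<le> z $ a" "z $ a < x $ a + 1" for a
    using z(1) unfolding x_def by simp_all
  define k where "k = int n - (\<lfloor>z $ 1\<rfloor> + \<lfloor>z $ 2\<rfloor> + \<lfloor>z $ 3\<rfloor>)"
  have k: "x$1 + x$2 + x$3 = real n - of_int k" unfolding x_def k_def by simp
  have "0 \<le> k" "k < 3"
    using z(2) k x(3,4)[of 1] x(3,4)[of 2] x(3,4)[of 3] by linarith+
  then consider "k = 0" | "k = 1" | "k = 2" by linarith
  then show ?thesis
  proof cases
    case 1
    then have "x$1 + x$2 + x$3 = z$1 + z$2 + z$3" using k z(2) by simp
    then have "x$1 = z$1" "x$2 = z$2" "x$3 = z$3"
      using x(3)[of 1] x(3)[of 2] x(3)[of 3] by linarith+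
    then have xz: "x = z" by (simp add: vec_eq_iff forall_3)
    have "\<exists>a. x $ a \<noteq> 0"
    proof (rule ccontr)
      assume "\<nexists>a. x $ a \<noteq> 0"
      then show False using z(2) assms(1) unfolding xz by simp
    qed
    then obtain a where a: "x $ a \<noteq> 0" by blast
    have "(\<Sum>a\<in>UNIV. x $ a) = real n" using k 1 unfolding sum_3 by linarith
    moreover have "1 \<le> x $ a" using Ints_nonzero_abs_ge1[OF x(1) a] x(2)[of a] by linarith
    ultimately have "up_cell n (x - e a)"
      using x(1,2) \<open>(\<Sum>a\<in>UNIV. x $ a) = real n\<close> unfolding up_cell_iff
      by (simp add: axis_component sum_subtractf)
    moreover have "z \<in> up_triangle (x - e a)"
      unfolding xz up_triangle_eq by (simp add: sum_subtractf axis_component)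
    ultimately show ?thesis unfolding unit_triangle_def by blast
  next
    case 2
    have "x$1 + x$2 + x$3 = real n - 1" "z$1 + z$2 + z$3 = x$1 + x$2 + x$3 + 1"
      using k 2 z(2) by linarith+
    then have "up_cell n x" "z \<in> up_triangle x"
      using x(1-3) unfolding up_cell_iff up_triangle_eq sum_3 by blast+
    then show ?thesis unfolding unit_triangle_def by blast
  next
    case 3
    have "x$1 + x$2 + x$3 = real n - 2" "z$1 + z$2 + z$3 = x$1 + x$2 + x$3 + 2"
      using k 3 z(2) by linarith+
    moreover have "\<forall>a. z $ a \<le> x $ a + 1" using x(4) less_imp_le by blast
    ultimately have "down_cell n x" "z \<in> down_triangle x"
      using x(1,2) unfolding down_cell_iff down_triangle_eq sum_3 by blast+
    then show ?thesis unfolding unit_triangle_def by blast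
  qed
qed

definition tiles :: "nat \<Rightarrow> (real ^ 3) set set" where
  "tiles n = up_triangles n \<union> unit_rhombi n"

lemma tile_cases:
  assumes "S \<in> tiles n"
  obtains x where "up_cell n x" "S = up_triangle x"
  | y b where "down_cell n y" "S = up_triangle (y + e b) \<union> down_triangle y"
proof -
  have "(\<exists>x. up_cell n x \<and> S = up_triangle x) \<or>
      (\<exists>y b. down_cell n y \<and> S = up_triangle (y + e b) \<union> down_triangle y)"
    using assms unfolding tiles_def up_triangles_def unit_rhombi_def forms_rhombus_iff up_cell_def
    by blast
  then show thesis using that by blast
qed

lemma up_triangle_tile: "up_cell n x \<Longrightarrow> up_triangle x \<in> up_triangles n"
  unfolding up_triangles_def up_cell_def by blast

lemma rhombus_tile: "down_cell n y \<Longrightarrow> up_triangle (y + e b) \<union> down_triangle y \<in> unit_rhombi n"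
  unfolding unit_rhombi_def forms_rhombus_iff by blast

lemma tile_contains_up_triangle:
  assumes "S \<in> tiles n" shows "\<exists>x. up_cell n x \<and> up_triangle x \<subseteq> S"
  using assms by (cases rule: tile_cases) (use up_cell_above_down_cell in blast)+

lemma tile_point_in_unit_triangle:
  assumes "S \<in> tiles n" "z \<in> S" shows "\<exists>U. unit_triangle n U \<and> U \<subseteq> S \<and> z \<in> U"
  using assms(1)
proof (cases rule: tile_cases)
  case (1 x)
  then show ?thesis using assms(2) unfolding unit_triangle_def by blast
next
  case (2 y b)
  then show ?thesis using assms(2) up_cell_above_down_cell unfolding unit_triangle_def by blast
qed

lemma tile_in_simplex: "S \<in> tiles n \<Longrightarrow> S \<subseteq> dilated_simplex n"
  using tile_point_in_unit_triangle unit_triangle_in_simplex by blast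

lemma unit_triangle_in_tile:
  assumes "unit_triangle n U" "S \<in> tiles n" "z \<in> U" "z \<in> S" "generic z"
  shows "U \<subseteq> S"
  using tile_point_in_unit_triangle[OF assms(2,4)] unit_triangle_generic_unique assms by metis

text \<open>
Covering the simplex and having disjoint relative interiors are both visible at generic points, and at those a
tile is just the set of its unit triangles. The equivalence turns tilings into combinatorial objects.
\<close>

lemma lozenge_tiling_iff:
  assumes "n \<ge> 1"
  shows "lozenge_tiling n T \<longleftrightarrow> T \<subseteq> tiles n \<and> (\<forall>U. unit_triangle n U \<longrightarrow> (\<exists>!S. S \<in> T \<and> U \<subseteq> S))"
proof (intro iffI conjI allI impI)
  assume T: "lozenge_tiling n T"
  then show sub: "T \<subseteq> tiles n" unfolding lozenge_tiling_def tiles_def by blast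
  fix U assume U: "unit_triangle n U"
  obtain z where z: "generic z" "z \<in> U" "ball z (1 / 3) \<inter> plane n \<subseteq> U"
    using unit_triangle_centre[OF U] by blast
  have "z \<in> \<Union> T" using T U z(2) unit_triangle_in_simplex unfolding lozenge_tiling_def by blast
  then obtain S where S: "S \<in> T" "z \<in> S" by blast
  have "U \<subseteq> S" using unit_triangle_in_tile U S sub z by blast
  moreover have "S' = S''" if "S' \<in> T" "U \<subseteq> S'" "S'' \<in> T" "U \<subseteq> S''" for S' S''
  proof (rule ccontr)
    assume "S' \<noteq> S''"
    then have "disjnt (rel_interior S') (rel_interior S'')"
      using T that unfolding lozenge_tiling_def by (auto dest: pairwiseD)
    moreover have "z \<in> rel_interior S' \<inter> rel_interior S''"
    proof (intro IntI centre_in_rel_interior[OF z(2,3)] that)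
      have "S' \<in> tiles n" "S'' \<in> tiles n" using that sub by blast+
      then show "S' \<subseteq> plane n" "S'' \<subseteq> plane n"
        using tile_in_simplex simplex_in_plane by (meson subset_trans)+
    qed
    ultimately show False unfolding disjnt_def by blast
  qed
  ultimately show "\<exists>!S. S \<in> T \<and> U \<subseteq> S" using S(1) by (intro ex1I[of _ S]) simp_all
next
  assume T: "T \<subseteq> tiles n \<and> (\<forall>U. unit_triangle n U \<longrightarrow> (\<exists>!S. S \<in> T \<and> U \<subseteq> S))"
  then have sub: "T \<subseteq> tiles n" by blast
  have unique: "S = S'" if "unit_triangle n U" "S \<in> T" "U \<subseteq> S" "S' \<in> T" "U \<subseteq> S'" for U S S'
    using T that by (metis (no_types, lifting))
  have "\<Union> T = dilated_simplex n"
  proof (intro subset_antisym subsetI)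
    fix z assume "z \<in> \<Union> T"
    then show "z \<in> dilated_simplex n" using sub tile_in_simplex by (meson UnionE subsetD)
  next
    fix z assume "z \<in> dilated_simplex n"
    then obtain U where "unit_triangle n U" "z \<in> U" using simplex_covered assms by blast
    moreover have "\<exists>S. S \<in> T \<and> U \<subseteq> S" using T \<open>unit_triangle n U\<close> by (metis (no_types, lifting))
    ultimately show "z \<in> \<Union> T" by blast
  qed
  moreover have "disjnt (rel_interior S) (rel_interior S')"
    if S: "S \<in> T" "S' \<in> T" "S \<noteq> S'" for S S'
  proof (rule ccontr)
    assume "\<not> ?thesis"
    then obtain z where z: "z \<in> rel_interior S" "z \<in> rel_interior S'" unfolding disjnt_def by blast
    have tiles: "S \<in> tiles n" "S' \<in> tiles n" using S sub by blast+
    have "z \<in> plane n"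
      using z(1) rel_interior_subset tile_in_simplex[OF tiles(1)] simplex_in_plane by blast
    moreover have "plane n \<subseteq> affine hull S" "plane n \<subseteq> affine hull S'"
      using tile_contains_up_triangle tiles plane_in_affine_hull by metis+
    ultimately obtain z' where z': "generic z'" "z' \<in> S" "z' \<in> S'"
      using generic_common_point z by blast
    obtain U where U: "unit_triangle n U" "U \<subseteq> S" "z' \<in> U"
      using tile_point_in_unit_triangle tiles(1) z'(2) by blast
    then have "U \<subseteq> S'" using unit_triangle_in_tile tiles(2) z' by blast
    then show False using unique U S by metis
  qed
  ultimately show "lozenge_tiling n T"
    using sub unfolding lozenge_tiling_def tiles_def by (simp add: pairwise_def)
qed

lemma up_triangle_inject: "up_triangle x = up_triangle x' \<longleftrightarrow> x = x'"
proof
  have le: "x' $ b \<le> x $ b" if "up_triangle x = up_triangle x'" for x x' :: "real^3" and b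
  proof -
    obtain c where "c \<noteq> b" using third_label by blast
    have "x + e c \<in> up_triangle x"
      unfolding up_triangle_eq by (simp add: sum.distrib axis_component)
    then have "x + e c \<in> up_triangle x'" unfolding that .
    then have "x' $ b \<le> (x + e c) $ b" unfolding up_triangle_eq by blast
    then show ?thesis using \<open>c \<noteq> b\<close> by (simp add: axis_component)
  qed
  assume eq: "up_triangle x = up_triangle x'"
  have "x $ b = x' $ b" for b using le[OF eq] le[OF eq[symmetric]] by (rule antisym[rotated])
  then show "x = x'" by (simp add: vec_eq_iff)
qed simp

lemma up_triangle_neq_down_triangle:
  assumes "up_cell n x" "down_cell n y" shows "up_triangle x \<noteq> down_triangle y"
proof
  assume eq: "up_triangle x = down_triangle y"
  have "unit_triangle n (up_triangle x)" using assms(1) unfolding unit_triangle_def by blast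
  then obtain z where "generic z" "z \<in> up_triangle x" using unit_triangle_centre by blast
  then have "x = y"
    using up_triangle_generic[OF assms(1)] down_triangle_generic[OF assms(2)] eq by metis
  then show False using assms unfolding up_cell_iff down_cell_iff by auto
qed

lemma unit_triangle_in_rhombus:
  assumes "unit_triangle n U" "down_cell n y" "U \<subseteq> up_triangle (y + e b) \<union> down_triangle y"
  shows "U = up_triangle (y + e b) \<or> U = down_triangle y"
proof -
  obtain z where z: "generic z" "z \<in> U" using unit_triangle_centre[OF assms(1)] by blast
  have "unit_triangle n (up_triangle (y + e b))" "unit_triangle n (down_triangle y)"
    using assms(2) up_cell_above_down_cell unfolding unit_triangle_def by blast+
  moreover have "z \<in> up_triangle (y + e b) \<or> z \<in> down_triangle y" using assms(3) z(2) by blast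
  ultimately show ?thesis
    using unit_triangle_generic_unique[OF assms(1) _ z(2) _ z(1)] by blast
qed

lemma unit_triangle_in_up_triangle:
  assumes "unit_triangle n U" "up_cell n x" "U \<subseteq> up_triangle x"
  shows "U = up_triangle x"
proof -
  obtain z where z: "generic z" "z \<in> U" using unit_triangle_centre[OF assms(1)] by blast
  have "unit_triangle n (up_triangle x)" using assms(2) unfolding unit_triangle_def by blast
  moreover have "z \<in> up_triangle x" using assms(3) z(2) by blast
  ultimately show ?thesis using unit_triangle_generic_unique[OF assms(1) _ z(2) _ z(1)] by blast
qed

lemma down_triangle_inject:
  assumes "down_cell n y" "down_cell n y'" "down_triangle y = down_triangle y'"
  shows "y = y'"
proof -
  have "unit_triangle n (down_triangle y)" using assms(1) unfolding unit_triangle_def by blast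
  then obtain z where "generic z" "z \<in> down_triangle y" using unit_triangle_centre by blast
  then show ?thesis using down_triangle_generic assms by metis
qed

lemma rhombus_inject:
  assumes "down_cell n y" "down_cell n y'"
    and "up_triangle (y + e b) \<union> down_triangle y = up_triangle (y' + e b') \<union> down_triangle y'"
  shows "y = y' \<and> b = b'"
proof -
  have cells: "up_cell n (y + e b)" "up_cell n (y' + e b')"
    using assms(1,2) up_cell_above_down_cell by blast+
  have units: "unit_triangle n (up_triangle (y + e b))" "unit_triangle n (down_triangle y)"
    using assms(1) cells unfolding unit_triangle_def by blast+
  have "down_triangle y = down_triangle y'"
    using unit_triangle_in_rhombus[OF units(2) assms(2), of b'] assms
      up_triangle_neq_down_triangle[OF cells(2) assms(1)] by (metis Un_upper2)
  then have "y = y'" using down_triangle_inject assms by blast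
  have "up_triangle (y + e b) = up_triangle (y' + e b')"
    using unit_triangle_in_rhombus[OF units(1) assms(2), of b'] assms
      up_triangle_neq_down_triangle[OF cells(1) assms(2)] by (metis Un_upper1)
  then have "e b = e b'" using \<open>y = y'\<close> up_triangle_inject by simp
  then show ?thesis using \<open>y = y'\<close> by (simp add: axis_eq_axis)
qed

section \<open>Rays in a matching of downward with upward triangles\<close>

lemma up_cell_less_imp_plus_one_le:
  assumes "up_cell n x" "up_cell n z" "x $ a < z $ a'" shows "x $ a + 1 \<le> z $ a'"
proof -
  have "x $ a \<in> \<int>" "z $ a' \<in> \<int>" using assms unfolding up_cell_iff by blast+
  then obtain k l where kl: "x $ a = of_int k" "z $ a' = of_int l" by (auto elim!: Ints_cases)
  then have "k + 1 \<le> l" using assms(3) by simp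
  then have "of_int (k + 1) \<le> (of_int l :: real)" by (simp only: of_int_le_iff)
  then show ?thesis unfolding kl by simp
qed

text \<open>
All upward cells have the same coordinate sum.
\<close>

lemma up_cell_eqI:
  assumes "up_cell n x" "up_cell n z" "a \<noteq> b" "x $ a = z $ a" "x $ b = z $ b"
  shows "x = z"
proof -
  have "x$1 + x$2 + x$3 = z$1 + z$2 + z$3"
    using assms(1,2) unfolding up_cell_iff sum_3 by simp
  then have "\<forall>c. x $ c = z $ c"
    using assms(3-5) exhaust_3[of a] exhaust_3[of b] unfolding forall_3 by auto
  then show ?thesis by (simp add: vec_eq_iff)
qed

text \<open>
Read \<open>M y b\<close> as: the downward triangle \<open>y\<close> and the upward triangle \<open>y + e b\<close> are glued along their sides
labelled \<open>b\<close>. The other sides of this rhombus with label \<open>a\<close> are the segments at \<open>y + e a\<close> and \<open>y + e b\<close>.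
The relation is directed away from the unit triangle of a colour and towards the edge \<open>x\<^sub>a = 0\<close>.
\<close>

definition crosses :: "(real ^ 3 \<Rightarrow> 3 \<Rightarrow> bool) \<Rightarrow> 3 \<Rightarrow> real ^ 3 \<Rightarrow> real ^ 3 \<Rightarrow> bool" where
  "crosses M a z z' \<longleftrightarrow> (\<exists>y b. M y b \<and> b \<noteq> a \<and> z = y + e a \<and> z' = y + e b)"

text \<open>
The rhombi of a tiling match downward triangles with upward ones; the upward triangles that remain are its unit
triangles.
\<close>

locale matching =
  fixes n :: nat and M :: "real ^ 3 \<Rightarrow> 3 \<Rightarrow> bool"
  assumes down_cell: "M y b \<Longrightarrow> down_cell n y"
    and functional: "M y b \<Longrightarrow> M y b' \<Longrightarrow> b = b'"
    and injective: "M y b \<Longrightarrow> M y' b' \<Longrightarrow> y + e b = y' + e b' \<Longrightarrow> y = y'"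
begin

definition unmatched :: "real ^ 3 \<Rightarrow> bool" where
  "unmatched x \<longleftrightarrow> up_cell n x \<and> (\<forall>y b. M y b \<longrightarrow> x \<noteq> y + e b)"

abbreviation ray :: "3 \<Rightarrow> real ^ 3 \<Rightarrow> real ^ 3 \<Rightarrow> bool" where
  "ray a \<equiv> (crosses M a)\<^sup>*\<^sup>*"

lemma crosses_cell: "crosses M a z z' \<Longrightarrow> up_cell n z \<and> up_cell n z'"
  unfolding crosses_def using down_cell up_cell_above_down_cell by blast

lemma crosses_level: "crosses M a z z' \<Longrightarrow> z' $ a = z $ a - 1"
  unfolding crosses_def by (auto simp: axis_component)

lemma crosses_component: "crosses M a z z' \<Longrightarrow> c \<noteq> a \<Longrightarrow> z $ c \<le> z' $ c \<and> z' $ c \<le> z $ c + 1"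
  unfolding crosses_def by (auto simp: axis_component)

lemma crosses_injective: "crosses M a z z' \<Longrightarrow> crosses M a w z' \<Longrightarrow> z = w"
  unfolding crosses_def using injective by metis

lemma not_crosses_unmatched: "crosses M a z x \<Longrightarrow> \<not> unmatched x"
  unfolding crosses_def unmatched_def by blast

lemma ray_cell: "ray a x z \<Longrightarrow> up_cell n x \<Longrightarrow> up_cell n z"
  by (induction rule: rtranclp_induct) (use crosses_cell in blast)+

lemma ray_component: "ray a x z \<Longrightarrow> c \<noteq> a \<Longrightarrow> x $ c \<le> z $ c"
  by (induction rule: rtranclp_induct) (use crosses_component order_trans in fastforce)+

lemma ray_level: "ray a x z \<Longrightarrow> x = z \<or> z $ a < x $ a"
  by (induction rule: rtranclp_induct) (auto dest: crosses_level)

text \<open>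
A step lowers coordinate \<open>a\<close> by exactly one, so a ray skips no level between its ends.
\<close>

lemma ray_through_level:
  assumes "ray a x z" "up_cell n x" "up_cell n q" "z $ a \<le> q $ a" "q $ a \<le> x $ a"
  shows "\<exists>p. ray a x p \<and> ray a p z \<and> p $ a = q $ a"
  using assms(1,2,5)
proof (induction rule: converse_rtranclp_induct)
  case base
  then show ?case using assms(4) by (intro exI[of _ z]) auto
next
  case (step x x')
  show ?case
  proof (cases "q $ a = x $ a")
    case True
    then show ?thesis using step by (intro exI[of _ x]) auto
  next
    case False
    then have "q $ a \<le> x' $ a"
      using up_cell_less_imp_plus_one_le[OF assms(3), of x a a] step crosses_level by fastforce
    then show ?thesis using step crosses_cell converse_rtranclp_into_rtranclp by metis
  qed
qed

text \<open>
From one level to the next, coordinate \<open>b\<close> of a ray stays or grows by one. The difference of two rays thus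
changes by at most one, and injectivity of the matching keeps it from becoming 0.
\<close>

lemma rays_stay_ordered:
  assumes "ray a p z" "ray a q z'" "up_cell n p" "up_cell n q" "a \<noteq> b"
    and "p $ a = q $ a" "z $ a = z' $ a" "q $ b < p $ b"
  shows "z' $ b < z $ b"
  using assms(1-4,6,8)
proof (induction arbitrary: q rule: converse_rtranclp_induct)
  case base
  then have "q = z'" using ray_level assms(7) by fastforce
  then show ?case using base by simp
next
  case (step p p')
  have "z $ a < q $ a" using step ray_level[of a p' z] crosses_level[of a p p'] by auto
  then obtain q' where q': "crosses M a q q'" "ray a q' z'"
    using step(4) assms(7) by (auto elim: converse_rtranclpE)
  have cells: "up_cell n p'" "up_cell n q'" using step(1) q'(1) crosses_cell by blast+
  have level: "p' $ a = q' $ a" using step q'(1) crosses_level by simp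
  have "q $ b + 1 \<le> p $ b"
    using up_cell_less_imp_plus_one_le[OF \<open>up_cell n q\<close> \<open>up_cell n p\<close>] step by blast
  then have le: "q' $ b \<le> p' $ b"
    using crosses_component[OF step(1), of b] crosses_component[OF q'(1), of b] assms(5) by auto
  moreover have "q' $ b \<noteq> p' $ b"
  proof
    assume "q' $ b = p' $ b"
    then have "q' = p'" using up_cell_eqI cells level assms(5) by metis
    then have "p = q" using crosses_injective step(1) q'(1) by blast
    then show False using step by simp
  qed
  ultimately show ?case using step(3)[OF q'(2) cells level] by simp
qed

text \<open>
When the ray of \<open>x\<close> comes down to the level of \<open>x'\<close>, its coordinate \<open>b\<close> has not decreased, so it passes \<open>x'\<close>
on the far side; it cannot hit \<open>x'\<close>, which is unmatched. From there on the two rays stay ordered.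
\<close>

lemma rays_ordered:
  assumes x: "unmatched x" "unmatched x'" "x \<noteq> x'" "a \<noteq> b"
    and le: "x' $ a \<le> x $ a" "x' $ b \<le> x $ b"
    and ray: "ray a x z" "ray a x' z'" "z $ a = 0" "z' $ a = 0"
  shows "z' $ b < z $ b"
proof -
  have cells: "up_cell n x" "up_cell n x'" using x unfolding unmatched_def by blast+
  then have "0 \<le> x' $ a" unfolding up_cell_iff by blast
  then obtain p where p: "ray a x p" "ray a p z" "p $ a = x' $ a"
    using ray_through_level[OF ray(1) cells] ray(3) le(1) by auto
  have p_cell: "up_cell n p" using ray_cell p cells by blast
  have "p \<noteq> x'"
    using p(1) x not_crosses_unmatched by (auto elim: rtranclp.cases)
  moreover have "x' $ b \<le> p $ b" using ray_component[OF p(1)] x(4) le(2) by fastforce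
  ultimately have "x' $ b < p $ b" using up_cell_eqI p_cell cells(2) x(4) p(3) by fastforce
  then show ?thesis
    using rays_stay_ordered[OF p(2) ray(2) p_cell cells(2) x(4) p(3)] ray(3,4) by simp
qed

text \<open>
Crossing back undoes the last step, because that step is the only way into the current segment; at the unmatched
start there is no way back.
\<close>

lemma ray_if_connected:
  assumes "(\<lambda>z z'. crosses M a z z' \<or> crosses M a z' z)\<^sup>*\<^sup>* x z" "unmatched x"
  shows "ray a x z"
  using assms(1)
proof (induction rule: rtranclp_induct)
  case (step z w)
  show ?case
  proof (cases "crosses M a z w")
    case True
    then show ?thesis using step by simp
  next
    case False
    then have "crosses M a w z" using step by blast
    moreover from \<open>ray a x z\<close> have "x = z \<or> (\<exists>v. ray a x v \<and> crosses M a v z)"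
      by (auto elim: rtranclp.cases)
    ultimately show ?thesis
      using not_crosses_unmatched assms(2) crosses_injective by metis
  qed
qed simp

text \<open>
Two of the three coordinates of \<open>x\<close> and \<open>x'\<close> compare in the same way. By \<open>rays_ordered\<close> the rays with those two
labels end in prescribed orders, which are opposite for the three cyclic comparisons in the assumptions.
\<close>

lemma not_all_ordered:
  assumes x: "unmatched x" "unmatched x'" "x \<noteq> x'"
    and ends: "\<And>a. ray a x (z a)" "\<And>a. z a $ a = 0" "\<And>a. ray a x' (z' a)" "\<And>a. z' a $ a = 0"
    and before: "z 3 $ 1 < z' 3 $ 1" "z 2 $ 3 < z' 2 $ 3" "z 1 $ 2 < z' 1 $ 2"
  shows False
proof -
  have sums: "z a $ 1 + z a $ 2 + z a $ 3 = real n - 1" "z' a $ 1 + z' a $ 2 + z' a $ 3 = real n - 1" for a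
    using ray_cell[OF ends(1), of a] ray_cell[OF ends(3), of a] x
    unfolding unmatched_def up_cell_iff sum_3 by auto
  have zero: "z 1 $ 1 = 0" "z 2 $ 2 = 0" "z 3 $ 3 = 0" "z' 1 $ 1 = 0" "z' 2 $ 2 = 0" "z' 3 $ 3 = 0"
    using ends by simp_all
  \<comment> \<open>One argument for both ways of comparing: \<open>v\<close> is the triangle with the larger coordinates \<open>a\<close> and \<open>b\<close>.\<close>
  have sym: False if "a \<noteq> b" and le: "v' $ a \<le> v $ a" "v' $ b \<le> v $ b"
    and v: "(v, v', y, y') = (x, x', z, z') \<or> (v, v', y, y') = (x', x, z', z)" for a b v v' y y'
  proof -
    have "y' a $ b < y a $ b" "y' b $ a < y b $ a"
      using rays_ordered[of v v' a b "y a" "y' a"] rays_ordered[of v v' b a "y b" "y' b"]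
        x ends le \<open>a \<noteq> b\<close> v by auto
    moreover have "a = 1 \<or> a = 2 \<or> a = 3" "b = 1 \<or> b = 2 \<or> b = 3" using exhaust_3 by blast+
    ultimately show False
      using before sums[of 1] sums[of 2] sums[of 3] zero v \<open>a \<noteq> b\<close> by (elim disjE) auto
  qed
  have one: "(1::3) \<noteq> 2" "(1::3) \<noteq> 3" "(2::3) \<noteq> 3" by simp_all
  have "(\<exists>a b. a \<noteq> b \<and> x $ a \<le> x' $ a \<and> x $ b \<le> x' $ b) \<or>
    (\<exists>a b. a \<noteq> b \<and> x' $ a \<le> x $ a \<and> x' $ b \<le> x $ b)"
    using one linear[of "x $ 1" "x' $ 1"] linear[of "x $ 2" "x' $ 2"] linear[of "x $ 3" "x' $ 3"]
    by metis
  then show False using sym by blast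
qed

end

section \<open>Systems of permutations of tilings are acyclic\<close>

definition mate :: "nat \<Rightarrow> (real ^ 3) set set \<Rightarrow> real ^ 3 \<Rightarrow> 3 \<Rightarrow> bool" where
  "mate n T y b \<longleftrightarrow> down_cell n y \<and> up_triangle (y + e b) \<union> down_triangle y \<in> T"

lemma tiling_unique:
  assumes "n \<ge> 1" "lozenge_tiling n T" "unit_triangle n U" "S \<in> T" "S' \<in> T" "U \<subseteq> S" "U \<subseteq> S'"
  shows "S = S'"
  using lozenge_tiling_iff[OF assms(1), of T] assms(2-7) by (metis (no_types, lifting))

lemma matching_mate:
  assumes "n \<ge> 1" "lozenge_tiling n T"
  shows "matching n (mate n T)"
proof
  fix y b assume "mate n T y b" then show "down_cell n y" unfolding mate_def by blast
next
  fix y b b' assume m: "mate n T y b" "mate n T y b'"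
  then have "unit_triangle n (down_triangle y)" unfolding mate_def unit_triangle_def by blast
  then have "up_triangle (y + e b) \<union> down_triangle y = up_triangle (y + e b') \<union> down_triangle y"
    by (rule tiling_unique[OF assms]) (use m in \<open>auto simp: mate_def\<close>)
  then show "b = b'" using m rhombus_inject unfolding mate_def by blast
next
  fix y b y' b' assume m: "mate n T y b" "mate n T y' b'" and eq: "y + e b = y' + e b'"
  then have "unit_triangle n (up_triangle (y + e b))"
    unfolding mate_def unit_triangle_def using up_cell_above_down_cell by blast
  then have "up_triangle (y + e b) \<union> down_triangle y = up_triangle (y' + e b') \<union> down_triangle y'"
    by (rule tiling_unique[OF assms]) (use m eq in \<open>auto simp: mate_def\<close>)
  then show "y = y'" using m rhombus_inject unfolding mate_def by blast
qed

lemma unmatched_triangle: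
  assumes "n \<ge> 1" "lozenge_tiling n T" "up_cell n x" "up_triangle x \<in> T"
  shows "matching.unmatched n (mate n T) x"
proof -
  interpret matching n "mate n T" using matching_mate assms(1,2) .
  have "x \<noteq> y + e b" if m: "mate n T y b" for y b
  proof
    assume x: "x = y + e b"
    have "unit_triangle n (up_triangle x)" using assms(3) unfolding unit_triangle_def by blast
    then have "up_triangle x = up_triangle (y + e b) \<union> down_triangle y"
      by (rule tiling_unique[OF assms(1,2)]) (use m x assms(4) in \<open>auto simp: mate_def\<close>)
    then have sub: "down_triangle y \<subseteq> up_triangle x" by blast
    have "down_cell n y" using m unfolding mate_def by blast
    then have "unit_triangle n (down_triangle y)" unfolding unit_triangle_def by blast
    from unit_triangle_in_up_triangle[OF this assms(3) sub] show False
      using up_triangle_neq_down_triangle[OF assms(3) \<open>down_cell n y\<close>] by simp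
  qed
  then show ?thesis unfolding unmatched_def using assms(3) by blast
qed

text \<open>
A side determines its label, so the rays of a colour never change direction.
\<close>

lemma opposite_sides_iff:
  "opposite_sides n R (up_side z a) t \<longleftrightarrow>
     (\<exists>y b z'. down_cell n y \<and> R = up_triangle (y + e b) \<union> down_triangle y \<and> a \<noteq> b \<and> t = up_side z' a \<and>
        (z = y + e a \<and> z' = y + e b \<or> z' = y + e a \<and> z = y + e b))"
  unfolding opposite_sides_def forms_rhombus_iff down_side_eq_up_side doubleton_eq_iff
  by (auto simp: up_side_inject)

lemma spreads_along_mates:
  assumes "(\<lambda>s s'. \<exists>R\<in>T. opposite_sides n R s s')\<^sup>*\<^sup>* (up_side x a) t"
  shows "\<exists>z. t = up_side z a \<and>
    (\<lambda>z z'. crosses (mate n T) a z z' \<or> crosses (mate n T) a z' z)\<^sup>*\<^sup>* x z"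
  using assms
proof (induction rule: rtranclp_induct)
  case (step s t)
  then obtain z R where z: "s = up_side z a" "R \<in> T" "opposite_sides n R (up_side z a) t"
    "(\<lambda>z z'. crosses (mate n T) a z z' \<or> crosses (mate n T) a z' z)\<^sup>*\<^sup>* x z" by blast
  from z(3) obtain y b z' where y: "down_cell n y" "R = up_triangle (y + e b) \<union> down_triangle y"
    "a \<noteq> b" "t = up_side z' a" "z = y + e a \<and> z' = y + e b \<or> z' = y + e a \<and> z = y + e b"
    unfolding opposite_sides_iff by (elim exE conjE)
  then have "mate n T y b" using z(2) unfolding mate_def by blast
  then have "crosses (mate n T) a z z' \<or> crosses (mate n T) a z' z"
    using y(3,5) unfolding crosses_def by blast
  with y(4) show ?case using z(4) by (metis (no_types, lifting) rtranclp.rtrancl_into_rtrancl)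
qed blast

lemma spreads_imp_ray:
  assumes "n \<ge> 1" "lozenge_tiling n T" "up_cell n x" "up_triangle x \<in> T"
    and "spreads n T (up_triangle x) (up_side z a)"
  shows "(crosses (mate n T) a)\<^sup>*\<^sup>* x z"
proof -
  obtain x' a' where "up_triangle x = up_triangle x'" and
    path: "(\<lambda>s s'. \<exists>R\<in>T. opposite_sides n R s s')\<^sup>*\<^sup>* (up_side x' a') (up_side z a)"
    using assms(5) unfolding spreads_def by blast
  then have "x' = x" using up_triangle_inject by metis
  then have "(\<lambda>z z'. crosses (mate n T) a z z' \<or> crosses (mate n T) a z' z)\<^sup>*\<^sup>* x z"
    using spreads_along_mates[OF path] by (auto simp: up_side_inject)
  then show ?thesis
    by (rule matching.ray_if_connected[OF matching_mate[OF assms(1,2)] _ unmatched_triangle[OF assms(1-4)]])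
qed

lemma crosses_imp_spread:
  assumes "crosses M a z z'"
    and "\<And>y b. M y b \<Longrightarrow> down_cell n y \<and> up_triangle (y + e b) \<union> down_triangle y \<in> T"
  shows "\<exists>R\<in>T. opposite_sides n R (up_side z a) (up_side z' a)"
  using assms unfolding opposite_sides_iff crosses_def by metis

definition edge_cell :: "nat \<Rightarrow> 3 \<Rightarrow> 3 \<Rightarrow> nat \<Rightarrow> real ^ 3" where
  "edge_cell n p q k = axis p (real n - 1 - real k) + axis q (real k)"

lemma edge_segment_eq_up_side:
  assumes "{b. b \<noteq> a} = {p, q}"
  shows "edge_segment n p q k = up_side (edge_cell n p q k) a"
proof -
  have "edge_cell n p q k + e p = axis p (real n - real k) + axis q (real k)"
    "edge_cell n p q k + e q = axis p (real n - real k - 1) + axis q (real k + 1)"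
    unfolding edge_cell_def by (simp_all add: vec_eq_iff axis_component)
  then show ?thesis unfolding edge_segment_def up_side_eq_segment[OF assms] by simp
qed

lemma other_labels: "{b. b \<noteq> (1::3)} = {3, 2}" "{b. b \<noteq> (2::3)} = {1, 3}" "{b. b \<noteq> (3::3)} = {2, 1}"
  using exhaust_3 by auto

lemma acyclic_if_tiling:
  assumes "n \<ge> 1" "lozenge_tiling n T" "numbering n T c" "system_of_permutations n T c u v w"
  shows "acyclic_system n u v w"
proof -
  interpret matching n "mate n T" using matching_mate assms(1,2) .
  have c: "inj_on c {1..n}" "\<forall>i\<in>{1..n}. c i \<in> T \<inter> up_triangles n"
    using assms(3) unfolding numbering_def bij_betw_def by auto
  have "\<forall>i\<in>{1..n}. \<exists>x. up_cell n x \<and> c i = up_triangle x \<and> c i \<in> T"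
    using c(2) unfolding up_triangles_def up_cell_def by fastforce
  then obtain x where x: "\<And>i. i \<in> {1..n} \<Longrightarrow> up_cell n (x i) \<and> c i = up_triangle (x i) \<and> up_triangle (x i) \<in> T"
    by metis
  have ends: "\<exists>z z'. ray a (x i) z \<and> z $ a = 0 \<and> ray a (x j) z' \<and> z' $ a = 0 \<and> z $ q < z' $ q"
    if reading: "edge_reading n T c p q s" and labels: "{b. b \<noteq> a} = {p, q}" "p \<noteq> q"
      and ij: "i \<in> {1..n}" "j \<in> {1..n}" "appears_before s i j" for a p q s i j
  proof -
    have "length s = n"
      using reading length_finite_permutations_of_set unfolding edge_reading_def by fastforce
    then obtain k l where kl: "k < l" "l < n" "s ! k = i" "s ! l = j"
      using ij(3) unfolding appears_before_def by blast
    have "spreads n T (up_triangle (x i)) (up_side (edge_cell n p q k) a)"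
      "spreads n T (up_triangle (x j)) (up_side (edge_cell n p q l) a)"
      using reading kl x ij(1,2) unfolding edge_reading_def edge_segment_eq_up_side[OF labels(1)]
      by (metis less_trans)+
    then have "ray a (x i) (edge_cell n p q k)" "ray a (x j) (edge_cell n p q l)"
      using spreads_imp_ray assms(1,2) x ij(1,2) by blast+
    moreover have "a \<noteq> p" "a \<noteq> q" using labels(1) by auto
    ultimately show ?thesis using kl(1) labels(2) unfolding edge_cell_def
      by (intro exI[of _ "edge_cell n p q k"] exI[of _ "edge_cell n p q l"])
        (simp add: edge_cell_def axis_component)
  qed
  show ?thesis unfolding acyclic_system_def
  proof (rule notI, elim bexE conjE)
    fix i j assume ij: "i \<in> {1..n}" "j \<in> {1..n}" "i \<noteq> j"
      and before: "appears_before u i j" "appears_before v i j" "appears_before w i j"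
    have readings: "edge_reading n T c 2 1 u" "edge_reading n T c 1 3 v" "edge_reading n T c 3 2 w"
      using assms(4) unfolding system_of_permutations_def by blast+
    obtain z1 z1' z2 z2' z3 z3' where z:
      "ray 3 (x i) z3 \<and> z3 $ 3 = 0 \<and> ray 3 (x j) z3' \<and> z3' $ 3 = 0 \<and> z3 $ 1 < z3' $ 1"
      "ray 2 (x i) z2 \<and> z2 $ 2 = 0 \<and> ray 2 (x j) z2' \<and> z2' $ 2 = 0 \<and> z2 $ 3 < z2' $ 3"
      "ray 1 (x i) z1 \<and> z1 $ 1 = 0 \<and> ray 1 (x j) z1' \<and> z1' $ 1 = 0 \<and> z1 $ 2 < z1' $ 2"
      using ends[OF readings(1) other_labels(3) _ ij(1,2) before(1)]
        ends[OF readings(2) other_labels(2) _ ij(1,2) before(2)]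
        ends[OF readings(3) other_labels(1) _ ij(1,2) before(3)] by auto
    define Z where "Z = (\<lambda>a::3. if a = 1 then z1 else if a = 2 then z2 else z3)"
    define Z' where "Z' = (\<lambda>a::3. if a = 1 then z1' else if a = 2 then z2' else z3')"
    have "\<forall>a. ray a (x i) (Z a) \<and> Z a $ a = 0 \<and> ray a (x j) (Z' a) \<and> Z' a $ a = 0"
      using z unfolding forall_3 Z_def Z'_def by simp
    moreover have "Z 3 $ 1 < Z' 3 $ 1" "Z 2 $ 3 < Z' 2 $ 3" "Z 1 $ 2 < Z' 1 $ 2"
      using z unfolding Z_def Z'_def by simp_all
    moreover have "x i \<noteq> x j" using c(1) x ij by (metis inj_onD)
    ultimately show False
      using not_all_ordered[of "x i" "x j" Z Z'] unmatched_triangle assms(1,2) x ij(1,2) by blast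
  qed
qed

section \<open>Sorting words by local moves\<close>

text \<open>
A word describes a path from \<open>B\<close> to \<open>A\<close>. The letter \<open>(a, i)\<close> is a unit segment with label \<open>a\<close>, part of a ray of
colour \<open>i\<close>; the path goes up to the right along a \<open>3\<close>, to the right along a \<open>1\<close> and up to the left along a \<open>2\<close>.
One step pushes the path over one tile to its right: over a unit triangle (\<open>split\<close>), which has label \<open>3\<close> on its
left and \<open>1\<close> and \<open>2\<close> on its other sides, or over a rhombus (\<open>swap\<close>).
\<close>

inductive sweep :: "(3 \<times> nat) list \<Rightarrow> (3 \<times> nat) list \<Rightarrow> bool" where
  split: "sweep (A @ (3, i) # B) (A @ (1, i) # (2, i) # B)"
| swap: "(a, b) \<in> {(3, 1), (2, 3), (2, 1)} \<Longrightarrow> sweep (A @ (a, i) # (b, j) # B) (A @ (b, j) # (a, i) # B)"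

lemma sweep_context: "sweep X Y \<Longrightarrow> sweep (A @ X @ B) (A @ Y @ B)"
proof (induction rule: sweep.induct)
  case (split A' i B')
  show ?case using sweep.split[of "A @ A'" i "B' @ B"] by simp
next
  case (swap a b A' i j B')
  then show ?case using sweep.swap[of a b "A @ A'" i j "B' @ B"] by simp
qed

lemma sweeps_context: "sweep\<^sup>*\<^sup>* X Y \<Longrightarrow> sweep\<^sup>*\<^sup>* (A @ X @ B) (A @ Y @ B)"
  by (induction rule: rtranclp_induct) (auto intro: rtranclp.rtrancl_into_rtrancl dest: sweep_context)

lemma sweep_one_left:
  assumes "\<forall>x\<in>set X. fst x \<noteq> 1" shows "sweep\<^sup>*\<^sup>* (X @ [(1, j)]) ((1, j) # X)"
  using assms
proof (induction X)
  case (Cons x X)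
  obtain a i where x: "x = (a, i)" by force
  then have "(a, 1) \<in> {(3, 1), (2, 3), (2, 1 :: 3)}" using Cons.prems exhaust_3[of a] by auto
  then have "sweep (x # (1, j) # X) ((1, j) # x # X)" using sweep.swap[of a 1 "[]"] unfolding x by simp
  moreover have "sweep\<^sup>*\<^sup>* (x # X @ [(1, j)]) (x # (1, j) # X)"
    using sweeps_context[of "X @ [(1, j)]" "(1, j) # X" "[x]" "[]"] Cons by simp
  ultimately show ?case by simp
qed simp

lemma sweep_two_right:
  assumes "\<forall>x\<in>set X. fst x = 3" shows "sweep\<^sup>*\<^sup>* ((2, i) # X) (X @ [(2, i)])"
  using assms
proof (induction X)
  case (Cons x X)
  obtain j where x: "x = (3, j)" using Cons.prems by (cases x) auto
  have "sweep ((2, i) # x # X) (x # (2, i) # X)" using sweep.swap[of 2 3 "[]"] unfolding x by simp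
  moreover have "sweep\<^sup>*\<^sup>* (x # (2, i) # X) (x # X @ [(2, i)])"
    using sweeps_context[of "(2, i) # X" "X @ [(2, i)]" "[x]" "[]"] Cons by simp
  ultimately show ?case by (simp add: converse_rtranclp_into_rtranclp)
qed simp

lemma sweep_separate:
  assumes "\<forall>x\<in>set X. fst x = 2 \<or> fst x = 3"
  shows "sweep\<^sup>*\<^sup>* X (filter (\<lambda>x. fst x = 3) X @ filter (\<lambda>x. fst x = 2) X)"
  using assms
proof (induction X)
  case (Cons x X)
  let ?F3 = "filter (\<lambda>x. fst x = 3) X" and ?F2 = "filter (\<lambda>x. fst x = 2) X"
  have IH: "sweep\<^sup>*\<^sup>* (x # X) (x # ?F3 @ ?F2)"
    using sweeps_context[of X "?F3 @ ?F2" "[x]" "[]"] Cons by simp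
  show ?case
  proof (cases "fst x = 3")
    case True
    then show ?thesis using IH by simp
  next
    case False
    then obtain i where x: "x = (2, i)" using Cons.prems by (cases x) auto
    have "sweep\<^sup>*\<^sup>* ((2, i) # ?F3) (?F3 @ [(2, i)])" by (rule sweep_two_right) simp
    then have "sweep\<^sup>*\<^sup>* (x # ?F3 @ ?F2) (?F3 @ x # ?F2)"
      using sweeps_context[of "(2, i) # ?F3" "?F3 @ [(2, i)]" "[]" ?F2] unfolding x by simp
    with IH show ?thesis unfolding x by simp
  qed
qed simp

text \<open>
What must hold of two letters when the first is to the left of the second, for the word to be sortable into the
order of \<open>f\<close> on the letters \<open>1\<close> and of \<open>g\<close> on the letters \<open>2\<close>, colours being split in the order of \<open>f\<close>. Two
unsplit colours may have to be inverted among the \<open>1\<close>s or among the \<open>2\<close>s, but not both. The letters \<open>2\<close>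
cannot pass each other and move only to the right, so one that already has an unsplit colour on its left must
follow the \<open>2\<close> of that colour.
\<close>

definition admissible :: "(nat \<Rightarrow> nat) \<Rightarrow> (nat \<Rightarrow> nat) \<Rightarrow> 3 \<times> nat \<Rightarrow> 3 \<times> nat \<Rightarrow> bool" where
  "admissible f g x y \<longleftrightarrow> (case (x, y) of ((a, i), (b, j)) \<Rightarrow>
     (a = 3 \<longrightarrow> b = 3 \<longrightarrow> \<not> (f j \<le> f i \<and> g j \<le> g i)) \<and> (a = 2 \<longrightarrow> b = 3 \<longrightarrow> g i \<noteq> g j) \<and>
     (b = 2 \<longrightarrow> g i < g j))"

text \<open>
Induction on the order \<open>P\<close> in which the colours are split. Let \<open>j\<close> be the first of them. Every \<open>2\<^sub>i\<close> left of
\<open>3\<^sub>j\<close> with \<open>g j < g i\<close> has to pass \<open>3\<^sub>j\<close> first. It can also pass each \<open>3\<^sub>k\<close> in between: as \<open>f j < f k\<close>,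
admissibility gives \<open>g k < g j\<close>, so \<open>k\<close> must come before \<open>j\<close> and \<open>i\<close> among the \<open>2\<close>s anyway. Then \<open>j\<close> is
split and \<open>1\<^sub>j\<close> moves to the left end of the word.
\<close>

lemma sweep_sorting:
  assumes "sorted_wrt (admissible f g) X" "\<forall>x\<in>set X. fst x = 2 \<or> fst x = 3"
    and "{i. (3, i) \<in> set X} = set P" "sorted_wrt (\<lambda>i j. f i < f j) P" "inj_on g (set P)"
  shows "\<exists>Q. sweep\<^sup>*\<^sup>* X (map (Pair 1) P @ map (Pair 2) Q) \<and> set Q = snd ` set X \<and>
    sorted_wrt (\<lambda>i j. g i < g j) Q"
  using assms
proof (induction P arbitrary: X)
  case Nil
  then have two: "\<forall>x\<in>set X. fst x = 2" by force
  then have eq: "X = map (Pair 2) (map snd X)" by (induction X) (auto simp: prod_eq_iff)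
  moreover have "sorted_wrt (\<lambda>i j. g i < g j) (map snd X)"
    unfolding sorted_wrt_map using Nil(1)
    by (rule sorted_wrt_mono_rel[rotated]) (use two in \<open>force simp: admissible_def split: prod.splits\<close>)
  ultimately show ?case by (intro exI[of _ "map snd X"]) (simp flip: eq)
next
  case (Cons j P)
  have first: "f j < f k" if "k \<in> set P" for k using Cons.prems(4) that by simp
  obtain A B where X: "X = A @ (3, j) # B" using Cons.prems(3) by (metis insertI1 list.simps(15) mem_Collect_eq split_list)
  \<comment> \<open>The part of \<open>A\<close> from the first \<open>2\<close> that has to pass \<open>3\<^sub>j\<close> is \<open>A2\<close>; in it all \<open>2\<close>s have to pass.\<close>
  define stay where "stay = (\<lambda>x::3 \<times> nat. fst x = 3 \<or> g (snd x) < g j)"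
  define A1 A2 where "A1 = takeWhile stay A" and "A2 = dropWhile stay A"
  have A: "A = A1 @ A2" unfolding A1_def A2_def by simp
  define F3 F2 where "F3 = filter (\<lambda>x. fst x = 3) A2" and "F2 = filter (\<lambda>x. fst x = 2) A2"
  define X' where "X' = A1 @ F3 @ (2, j) # F2 @ B"
  have labels: "fst x = 2 \<or> fst x = 3" if "x \<in> set A1 \<union> set A2 \<union> set B" for x
    using Cons.prems(2) that unfolding X A by auto
  have "sweep\<^sup>*\<^sup>* (A2 @ [(3, j)]) (F3 @ [(3, j)] @ F2)"
    using sweep_separate[of "A2 @ [(3, j)]"] labels unfolding F3_def F2_def by auto
  from sweeps_context[OF this, of A1 B] have "sweep\<^sup>*\<^sup>* X (A1 @ F3 @ (3, j) # F2 @ B)"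
    unfolding X A by simp
  also have "sweep (A1 @ F3 @ (3, j) # F2 @ B) ((A1 @ F3) @ (1, j) # (2, j) # F2 @ B)"
    using sweep.split[of "A1 @ F3" j "F2 @ B"] by simp
  also have "sweep\<^sup>*\<^sup>* ((A1 @ F3) @ (1, j) # (2, j) # F2 @ B) ((1, j) # X')"
  proof -
    have "\<forall>x\<in>set (A1 @ F3). fst x \<noteq> 1" using labels unfolding F3_def by fastforce
    from sweeps_context[OF sweep_one_left[OF this, of j], of "[]" "(2, j) # F2 @ B"]
    show ?thesis unfolding X'_def by simp
  qed
  finally have steps: "sweep\<^sup>*\<^sup>* X ((1, j) # X')" .
  have sorted: "sorted_wrt (admissible f g) (A1 @ A2 @ (3, j) # B)" using Cons.prems(1) unfolding X A by simp
  have three_before: "g k < g j" if "(3, k) \<in> set A1 \<union> set A2" for k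
  proof -
    have "admissible f g (3, k) (3, j)" using sorted that by (auto simp: sorted_wrt_append)
    moreover have "k \<in> set (j # P)" using that Cons.prems(3) unfolding X A by auto
    ultimately show ?thesis using first[of k] by (auto simp: admissible_def)
  qed
  have A1: "g i < g j" if "(2, i) \<in> set A1" for i
    using that unfolding A1_def stay_def by (auto dest: set_takeWhileD)
  have F2: "g j < g i" if i: "(2, i) \<in> set A2" for i
  proof -
    have "A2 \<noteq> []" using i by auto
    then obtain x A2' where A2': "A2 = x # A2'" by (cases A2) auto
    have "\<not> stay x" using A2' unfolding A2_def by (metis hd_dropWhile list.distinct(1) list.sel(1))
    then obtain l where x: "x = (2, l)" using labels[of x] A2' unfolding stay_def by (cases x) auto
    have "admissible f g (2, l) (3, j)" using sorted unfolding A2' x by (auto simp: sorted_wrt_append)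
    then have "g j < g l" using \<open>\<not> stay x\<close> unfolding stay_def x admissible_def by simp
    moreover have "g l \<le> g i"
    proof (cases "(2, i) = x")
      case False
      then have "admissible f g x (2, i)" using sorted i unfolding A2' by (auto simp: sorted_wrt_append)
      then show ?thesis unfolding x admissible_def by simp
    qed (simp add: x)
    ultimately show ?thesis by simp
  qed
  have B: "g j < g i" if "(2, i) \<in> set B" for i
    using sorted that by (auto simp: sorted_wrt_append admissible_def)
  have other: "k \<in> set P \<and> g k \<noteq> g j" if "(3, k) \<in> set A1 \<union> set A2 \<union> set B" for k
  proof -
    have "admissible f g (3, k) (3, j) \<or> admissible f g (3, j) (3, k)"
      using sorted that by (auto simp: sorted_wrt_append)
    then have "k \<noteq> j" by (auto simp: admissible_def)
    moreover have "k \<in> set (j # P)" using that Cons.prems(3) unfolding X A by auto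
    ultimately show ?thesis using Cons.prems(5) by (auto simp: inj_on_def)
  qed
  have "sorted_wrt (admissible f g) X'"
  proof -
    have "sorted_wrt (admissible f g) F3" "sorted_wrt (admissible f g) F2"
      using sorted unfolding F3_def F2_def by (simp_all add: sorted_wrt_append sorted_wrt_filter)
    moreover have "admissible f g x (2, j)" if "x \<in> set A1 \<union> set F3" for x
      using that A1 three_before labels[of x] unfolding F3_def admissible_def by (cases x) auto
    moreover have "admissible f g x y" if "x \<in> set F3" "y \<in> set F2" for x y
    proof -
      have "x \<in> set A2" "fst x = 3" "y \<in> set A2" "fst y = 2" using that unfolding F3_def F2_def by simp_all
      moreover obtain k i where "x = (3, k)" "y = (2, i)" using calculation by (metis prod.collapse)
      ultimately show ?thesis using three_before[of k] F2[of i] unfolding admissible_def by simp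
    qed
    moreover have "admissible f g (2, j) y" if "y \<in> set F2 \<union> set B" for y
      using that F2 B other[of "snd y"] labels[of y] unfolding F2_def admissible_def by (cases y) auto
    ultimately show ?thesis
      using sorted unfolding X'_def F3_def F2_def by (auto simp: sorted_wrt_append)
  qed
  moreover have "\<forall>x\<in>set X'. fst x = 2 \<or> fst x = 3"
    using labels unfolding X'_def F3_def F2_def by auto
  moreover have "{i. (3, i) \<in> set X'} = set P"
  proof -
    have "j \<notin> set P" using first by blast
    moreover have "(3, k) \<in> set X' \<longleftrightarrow> (3, k) \<in> set A1 \<union> set A2 \<union> set B" for k
      unfolding X'_def F3_def F2_def by auto
    moreover have "(3, k) \<in> set A1 \<union> set A2 \<union> set B \<or> k = j \<longleftrightarrow> k \<in> set (j # P)" for k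
      using Cons.prems(3) unfolding X A by auto
    ultimately show ?thesis using other by auto
  qed
  ultimately obtain Q where Q: "sweep\<^sup>*\<^sup>* X' (map (Pair 1) P @ map (Pair 2) Q)"
    "set Q = snd ` set X'" "sorted_wrt (\<lambda>i j. g i < g j) Q"
    using Cons.IH[of X'] Cons.prems(4,5) by auto
  have "set A2 = set F3 \<union> set F2" using labels unfolding F3_def F2_def by auto
  then have "set Q = snd ` set X" unfolding Q(2) X'_def X A by auto
  moreover have "sweep\<^sup>*\<^sup>* X (map (Pair 1) (j # P) @ map (Pair 2) Q)"
    using rtranclp_trans[OF steps] sweeps_context[OF Q(1), of "[(1, j)]" "[]"] by simp
  ultimately show ?case using Q(3) by blast
qed

definition rank :: "nat list \<Rightarrow> nat \<Rightarrow> nat" where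
  "rank xs = inv_into {..<length xs} ((!) xs)"

lemma rank_nth: "distinct xs \<Longrightarrow> k < length xs \<Longrightarrow> rank xs (xs ! k) = k"
  unfolding rank_def by (simp add: inv_into_f_f inj_on_nth)

lemma rank_less_length: "distinct xs \<Longrightarrow> x \<in> set xs \<Longrightarrow> rank xs x < length xs \<and> xs ! rank xs x = x"
  by (auto simp: in_set_conv_nth rank_nth)

lemma inj_on_rank: "distinct xs \<Longrightarrow> inj_on (rank xs) (set xs)"
  by (metis inj_on_def rank_less_length)

lemma sorted_wrt_rank: "distinct xs \<Longrightarrow> sorted_wrt (\<lambda>i j. rank xs i < rank xs j) xs"
  by (simp add: sorted_wrt_iff_nth_less rank_nth)

lemma appears_before_iff_rank:
  assumes "distinct xs" "i \<in> set xs" "j \<in> set xs"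
  shows "appears_before xs i j \<longleftrightarrow> rank xs i < rank xs j"
  using assms unfolding appears_before_def by (metis rank_less_length rank_nth order.strict_trans)

lemma appears_before_rev: "appears_before (rev xs) i j \<Longrightarrow> appears_before xs j i"
  unfolding appears_before_def
proof (elim exE conjE)
  fix p q assume "p < q" "q < length (rev xs)" "rev xs ! p = i" "rev xs ! q = j"
  then show "\<exists>p q. p < q \<and> q < length xs \<and> xs ! p = j \<and> xs ! q = i"
    by (intro exI[of _ "length xs - Suc q"] exI[of _ "length xs - Suc p"]) (auto simp: rev_nth)
qed

lemma sorted_by_rank_unique:
  assumes "distinct xs" "set ys = set xs" "sorted_wrt (\<lambda>i j. rank xs i < rank xs j) ys"
  shows "ys = xs"
proof -
  have "sorted_wrt (<) (map (rank xs) ys)" "sorted_wrt (<) (map (rank xs) xs)"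
    using assms(3) sorted_wrt_rank[OF assms(1)] by (simp_all add: sorted_wrt_map)
  then have "map (rank xs) ys = map (rank xs) xs"
    by (intro strict_sorted_equal) (simp_all add: assms(2))
  then show ?thesis using inj_on_rank[OF assms(1)] assms(2) by (simp add: inj_on_map_eq_map)
qed

text \<open>
The sweep ends on the bottom edge read from \<open>B\<close> to \<open>C\<close> and the right edge read from \<open>C\<close> to \<open>A\<close>, both
counterclockwise, which is why \<open>w\<close> and \<open>v\<close> are reversed. A pair of colours violating admissibility of the
initial word is in the same order in \<open>u\<close>, \<open>v\<close> and \<open>w\<close>.
\<close>

lemma sweep_if_acyclic:
  assumes u: "u \<in> permutations_of_set {1..n}" and v: "v \<in> permutations_of_set {1..n}"
    and w: "w \<in> permutations_of_set {1..n}" and acyclic: "acyclic_system n u v w"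
  shows "sweep\<^sup>*\<^sup>* (map (Pair 3) u) (map (Pair 1) (rev w) @ map (Pair 2) (rev v))"
proof -
  note perms = permutations_of_setD[OF u] permutations_of_setD[OF v] permutations_of_setD[OF w]
  have rev: "distinct (rev v)" "distinct (rev w)" "set (rev v) = {1..n}" "set (rev w) = {1..n}"
    using perms by simp_all
  have "admissible (rank (rev w)) (rank (rev v)) (3, u ! k) (3, u ! l)" if kl: "k < l" "l < length u" for k l
  proof (rule ccontr)
    assume "\<not> ?thesis"
    then have le: "rank (rev w) (u ! l) \<le> rank (rev w) (u ! k)" "rank (rev v) (u ! l) \<le> rank (rev v) (u ! k)"
      unfolding admissible_def by auto
    have mem: "u ! k \<in> {1..n}" "u ! l \<in> {1..n}"
      using kl perms(1) by (metis nth_mem order.strict_trans)+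
    have neq: "u ! k \<noteq> u ! l" using kl perms(2) by (simp add: nth_eq_iff_index_eq)
    have "rank (rev w) (u ! l) \<noteq> rank (rev w) (u ! k)" "rank (rev v) (u ! l) \<noteq> rank (rev v) (u ! k)"
      using inj_on_rank[OF rev(1)] inj_on_rank[OF rev(2)] mem neq unfolding rev(3,4) inj_on_def by metis+
    then have rev_before: "appears_before (rev w) (u ! l) (u ! k)" "appears_before (rev v) (u ! l) (u ! k)"
      using le mem rev by (simp_all add: appears_before_iff_rank)
    have "appears_before w (u ! k) (u ! l)" "appears_before v (u ! k) (u ! l)"
      using rev_before by (simp_all add: appears_before_rev)
    moreover have "appears_before u (u ! k) (u ! l)" using kl unfolding appears_before_def by blast
    ultimately show False
      using acyclic mem neq unfolding acyclic_system_def by metis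
  qed
  then have "sorted_wrt (admissible (rank (rev w)) (rank (rev v))) (map (Pair 3) u)"
    by (simp add: sorted_wrt_iff_nth_less)
  from sweep_sorting[OF this _ _ sorted_wrt_rank[OF rev(2)]] obtain Q
    where Q: "sweep\<^sup>*\<^sup>* (map (Pair 3) u) (map (Pair 1) (rev w) @ map (Pair 2) Q)"
      "set Q = {1..n}" "sorted_wrt (\<lambda>i j. rank (rev v) i < rank (rev v) j) Q"
    using perms rev inj_on_rank[OF rev(1)] by (auto simp: image_image)
  then have "Q = rev v" using sorted_by_rank_unique rev by metis
  then show ?thesis using Q(1) by simp
qed

section \<open>Words as lattice paths in the triangle\<close>

definition direction :: "3 \<Rightarrow> real ^ 3" where
  "direction a = (if a = 1 then e 3 - e 2 else if a = 2 then e 1 - e 3 else e 1 - e 2)"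

text \<open>
The segment with label \<open>a\<close> starting at \<open>p\<close> is the side labelled \<open>a\<close> of the upward triangle \<open>base p a\<close>.
\<close>

definition base :: "real ^ 3 \<Rightarrow> 3 \<Rightarrow> real ^ 3" where
  "base p a = (if a = 2 then p - e 3 else p - e 2)"

fun walk :: "real ^ 3 \<Rightarrow> (3 \<times> nat) list \<Rightarrow> real ^ 3" where
  "walk p [] = p"
| "walk p ((a, i) # W) = walk (p + direction a) W"

fun vertices :: "real ^ 3 \<Rightarrow> (3 \<times> nat) list \<Rightarrow> (real ^ 3) set" where
  "vertices p [] = {p}"
| "vertices p ((a, i) # W) = insert p (vertices (p + direction a) W)"

fun locate :: "real ^ 3 \<Rightarrow> (3 \<times> nat) list \<Rightarrow> ((real ^ 3) \<times> 3 \<times> nat) list" where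
  "locate p [] = []"
| "locate p ((a, i) # W) = (base p a, a, i) # locate (p + direction a) W"

lemma locate_append: "locate p (A @ B) = locate p A @ locate (walk p A) B"
  by (induction p A rule: walk.induct) simp_all

lemma vertices_append: "vertices p (A @ B) = vertices p A \<union> vertices (walk p A) B"
proof (induction p A rule: walk.induct)
  case (1 p)
  then show ?case by (cases B) auto
qed simp

lemma start_in_vertices: "p \<in> vertices p W"
  by (cases W) auto

lemma locate_monochrome:
  "locate p (map (Pair a) xs) = map (\<lambda>k. (base (p + real k *\<^sub>R direction a) a, a, xs ! k)) [0..<length xs]"
proof (induction xs arbitrary: p)
  case (Cons x xs)
  have *: "[0..<length (x # xs)] = 0 # map Suc [0..<length xs]"
    by (simp add: map_Suc_upt upt_conv_Cons del: upt_Suc)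
  show ?case unfolding * using Cons[of "p + direction a"] by (simp add: algebra_simps)
qed simp

lemma walk_monochrome: "walk p (map (Pair a) xs) = p + real (length xs) *\<^sub>R direction a"
  by (induction xs arbitrary: p) (simp_all add: algebra_simps)

lemma vertices_monochrome: "vertices p (map (Pair a) xs) = (\<lambda>k. p + real k *\<^sub>R direction a) ` {..length xs}"
proof (induction xs arbitrary: p)
  case (Cons x xs)
  have "{..length (x # xs)} = insert 0 (Suc ` {..length xs})" by (simp add: atMost_Suc_eq_insert_0)
  then show ?case using Cons[of "p + direction a"] by (simp add: image_image algebra_simps)
qed simp

lemma nat_vector_iff:
  "nat_vector n q \<longleftrightarrow> (\<forall>a. q $ a \<in> \<int> \<and> 0 \<le> q $ a) \<and> q$1 + q$2 + q$3 = real n"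
  unfolding nat_vector_def nats_iff sum_3 by auto

lemma split_geometry:
  assumes "nat_vector n p" "nat_vector n (p + direction 3)"
  shows "nat_vector n (p + direction 1)" "up_cell n (base p 3)"
    "p + direction 1 + direction 2 = p + direction 3"
    "base p 1 = base p 3" "base (p + direction 1) 2 = base p 3"
  using assms
  by (simp_all add: nat_vector_iff up_cell_iff direction_def base_def forall_3 axis_component sum_3)

text \<open>
Before and after an exchange, the path runs along two of the four sides of the rhombus made of the downward
triangle \<open>y\<close> and the upward triangle \<open>y + e c\<close>. The third label \<open>c\<close> belongs to the inner side. For the
labels \<open>1\<close> and \<open>2\<close> the rays run from the old side to the new one, for the label \<open>3\<close> from the new side to the
old one. No vertex leaves the simplex, as the later vertices of the old path bound the coordinates that decrease.
\<close>

lemma swap_geometry: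
  assumes "(a, b) \<in> {(3, 1), (2, 3), (2, 1)}"
    and "nat_vector n p" "nat_vector n (p + direction a)" "nat_vector n (p + direction a + direction b)"
  obtains y c where "{a, b, c} = UNIV" "c \<noteq> a" "c \<noteq> b" "down_cell n y" "nat_vector n (p + direction b)"
    "base p a = (if a = 3 then y + e c else y + e a)"
    "base (p + direction a) b = (if b = 3 then y + e c else y + e b)"
    "base p b = (if b = 3 then y + e b else y + e c)"
    "base (p + direction b) a = (if a = 3 then y + e a else y + e c)"
proof -
  have p: "\<And>l. p $ l \<in> \<int>" "\<And>l. 0 \<le> p $ l" "p$1 + p$2 + p$3 = real n"
    using assms(2) unfolding nat_vector_iff by blast+
  have nonneg: "0 \<le> (p + direction a) $ 3" "0 \<le> (p + direction a + direction b) $ 2"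
    using assms(3,4) unfolding nat_vector_iff by blast+
  have bounds: "a = 3 \<Longrightarrow> b = 1 \<Longrightarrow> 2 \<le> p $ 2" "a = 2 \<Longrightarrow> 1 \<le> p $ 2" "a = 2 \<Longrightarrow> 1 \<le> p $ 3"
    using nonneg assms(1) by (auto simp: direction_def axis_component)
  consider "a = 3" "b = 1" | "a = 2" "b = 3" | "a = 2" "b = 1" using assms(1) by auto
  then show thesis
  proof cases
    case 1
    show ?thesis
    proof (rule that[of 2 "p - e 2 - e 2"])
      show "{a, b, 2} = UNIV" "2 \<noteq> a" "2 \<noteq> b" unfolding 1 UNIV_3 by auto
      show "down_cell n (p - e 2 - e 2)"
        unfolding down_cell_iff sum_3 forall_3 using p bounds 1 by (simp add: axis_component)
      show "nat_vector n (p + direction b)"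
        unfolding nat_vector_iff forall_3 1 using p bounds 1 by (simp add: axis_component direction_def)
    qed (simp_all add: 1 base_def direction_def algebra_simps)
  next
    case 2
    show ?thesis
    proof (rule that[of 1 "p - e 2 - e 3"])
      show "{a, b, 1} = UNIV" "1 \<noteq> a" "1 \<noteq> b" unfolding 2 UNIV_3 by auto
      show "down_cell n (p - e 2 - e 3)"
        unfolding down_cell_iff sum_3 forall_3 using p bounds 2 by (simp add: axis_component)
      show "nat_vector n (p + direction b)"
        unfolding nat_vector_iff forall_3 2 using p bounds 2 by (simp add: axis_component direction_def)
    qed (simp_all add: 2 base_def direction_def algebra_simps)
  next
    case 3
    show ?thesis
    proof (rule that[of 3 "p - e 2 - e 3"])
      show "{a, b, 3} = UNIV" "3 \<noteq> a" "3 \<noteq> b" unfolding 3 UNIV_3 by auto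
      show "down_cell n (p - e 2 - e 3)"
        unfolding down_cell_iff sum_3 forall_3 using p bounds 3 by (simp add: axis_component)
      show "nat_vector n (p + direction b)"
        unfolding nat_vector_iff forall_3 3 using p bounds 3 by (simp add: axis_component direction_def)
    qed (simp_all add: 3 base_def direction_def algebra_simps)
  qed
qed

section \<open>Tiles swept by a path\<close>

abbreviation start :: "nat \<Rightarrow> real ^ 3" where "start n \<equiv> axis 2 (real n)"

text \<open>
The state of a sweep consists of the current word \<open>W\<close>, the list \<open>G\<close> of swept unit triangles with their colours
and the list \<open>R\<close> of swept rhombi \<open>(y, b)\<close>. Lists are used so that multiplicities are recorded.
\<close>

definition sides :: "nat \<Rightarrow> (3 \<times> nat) list \<Rightarrow> ((real ^ 3) \<times> 3) list" where
  "sides n W = map (\<lambda>(z, a, i). (z, a)) (locate (start n) W)"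

definition ups :: "(nat \<times> (real ^ 3)) list \<Rightarrow> ((real ^ 3) \<times> 3) list \<Rightarrow> (real ^ 3) list" where
  "ups G R = map snd G @ map (\<lambda>(y, b). y + e b) R"

definition runs :: "((real ^ 3) \<times> 3) list \<Rightarrow> 3 \<Rightarrow> real ^ 3 \<Rightarrow> real ^ 3 \<Rightarrow> bool" where
  "runs R a = (crosses (\<lambda>y b. (y, b) \<in> set R) a)\<^sup>*\<^sup>*"

lemma runs_Cons: "runs R a z z' \<Longrightarrow> runs (r # R) a z z'"
  unfolding runs_def
proof (erule mono_rtranclp[rule_format, rotated])
  fix z z' assume "crosses (\<lambda>y b. (y, b) \<in> set R) a z z'"
  then obtain y b where "(y, b) \<in> set (r # R)" "b \<noteq> a" "z = y + e a" "z' = y + e b"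
    unfolding crosses_def by auto
  then show "crosses (\<lambda>y b. (y, b) \<in> set (r # R)) a z z'" unfolding crosses_def by blast
qed

lemma runs_trans: "runs R a x y \<Longrightarrow> runs R a y z \<Longrightarrow> runs R a x z"
  unfolding runs_def by (rule rtranclp_trans)

text \<open>
Each segment of the path separates a swept unit triangle from one that is not swept. Counted with multiplicities,
this is a linear equation for each segment of the grid: on the side labelled \<open>3\<close> of an upward triangle, the
swept region enters from the downward triangle beyond it, or from outside if the segment is on the left edge;
on the sides labelled \<open>1\<close> and \<open>2\<close> it enters from the upward triangle. Being linear, the equations are preserved
by every move without any argument about the position of the path.
\<close>

definition balanced :: "nat \<Rightarrow> (3 \<times> nat) list \<Rightarrow> (nat \<times> (real ^ 3)) list \<Rightarrow> ((real ^ 3) \<times> 3) list \<Rightarrow> bool" where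
  "balanced n W G R \<longleftrightarrow> (\<forall>z. up_cell n z \<longrightarrow>
     count_list (sides n W) (z, 3) + count_list (ups G R) z =
       (if z $ 3 = 0 then 1 else 0) + count_list (map fst R) (z - e 3) \<and>
     count_list (sides n W) (z, 1) + count_list (map fst R) (z - e 1) = count_list (ups G R) z \<and>
     count_list (sides n W) (z, 2) + count_list (map fst R) (z - e 2) = count_list (ups G R) z)"

text \<open>
Each entry of \<open>u\<close> is accounted for once, by a letter \<open>3\<close> or by a unit triangle in \<open>G\<close>. Rays with label \<open>3\<close> are already
complete on the left; those with the labels \<open>1\<close> and \<open>2\<close> end at the path.
\<close>

definition coloured :: "nat \<Rightarrow> nat list \<Rightarrow> (3 \<times> nat) list \<Rightarrow> (nat \<times> (real ^ 3)) list \<Rightarrow> ((real ^ 3) \<times> 3) list \<Rightarrow> bool" where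
  "coloured n u W G R \<longleftrightarrow>
     mset (map fst G) + mset (map snd (filter (\<lambda>x. fst x = 3) W)) = mset u \<and>
     (\<forall>i x. (i, x) \<in> set G \<or> (x, 3, i) \<in> set (locate (start n) W) \<longrightarrow>
        (\<exists>z. (z, 3, i) \<in> set (locate (start n) (map (Pair 3) u)) \<and> runs R 3 x z)) \<and>
     (\<forall>a i z. a \<noteq> 3 \<and> (z, a, i) \<in> set (locate (start n) W) \<longrightarrow> (\<exists>x. (i, x) \<in> set G \<and> runs R a x z))"

definition in_simplex :: "nat \<Rightarrow> (3 \<times> nat) list \<Rightarrow> (nat \<times> (real ^ 3)) list \<Rightarrow> ((real ^ 3) \<times> 3) list \<Rightarrow> bool" where
  "in_simplex n W G R \<longleftrightarrow> (\<forall>q\<in>vertices (start n) W. nat_vector n q) \<and>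
     (\<forall>(i, x)\<in>set G. up_cell n x) \<and> (\<forall>(y, b)\<in>set R. down_cell n y)"

lemma split_step:
  assumes "in_simplex n (A @ (3, i) # B) G R" "balanced n (A @ (3, i) # B) G R"
    "coloured n u (A @ (3, i) # B) G R"
  shows "\<exists>G' R'. in_simplex n (A @ (1, i) # (2, i) # B) G' R' \<and> balanced n (A @ (1, i) # (2, i) # B) G' R' \<and>
    coloured n u (A @ (1, i) # (2, i) # B) G' R'"
proof -
  define p where "p = walk (start n) A"
  have p: "nat_vector n p" "nat_vector n (p + direction 3)"
    using assms(1) start_in_vertices unfolding in_simplex_def vertices_append p_def by auto
  note geo = split_geometry[OF p]
  define x where "x = base p 3"
  have locate: "locate (start n) (A @ (3, i) # B) =
      locate (start n) A @ (x, 3, i) # locate (p + direction 3) B"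
    "locate (start n) (A @ (1, i) # (2, i) # B) =
      locate (start n) A @ (x, 1, i) # (x, 2, i) # locate (p + direction 3) B"
    unfolding locate_append by (simp_all add: geo(3-5) x_def flip: p_def)
  have "in_simplex n (A @ (1, i) # (2, i) # B) ((i, x) # G) R"
    using assms(1) p geo(1,2) unfolding in_simplex_def vertices_append x_def
    by (auto simp: geo(3) simp flip: p_def)
  moreover have "balanced n (A @ (1, i) # (2, i) # B) ((i, x) # G) R"
    using assms(2) unfolding balanced_def sides_def locate ups_def by auto
  moreover have "coloured n u (A @ (1, i) # (2, i) # B) ((i, x) # G) R"
    unfolding coloured_def
  proof (intro conjI)
    show "mset (map fst ((i, x) # G)) + mset (map snd (filter (\<lambda>x. fst x = 3) (A @ (1, i) # (2, i) # B))) = mset u"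
      using assms(3) unfolding coloured_def by simp
    show "\<forall>j z. (j, z) \<in> set ((i, x) # G) \<or> (z, 3, j) \<in> set (locate (start n) (A @ (1, i) # (2, i) # B)) \<longrightarrow>
        (\<exists>z'. (z', 3, j) \<in> set (locate (start n) (map (Pair 3) u)) \<and> runs R 3 z z')"
      using assms(3) unfolding coloured_def locate by auto
    have "runs R a x x" for a unfolding runs_def by simp
    then show "\<forall>a j z. a \<noteq> 3 \<and> (z, a, j) \<in> set (locate (start n) (A @ (1, i) # (2, i) # B)) \<longrightarrow>
        (\<exists>x'. (j, x') \<in> set ((i, x) # G) \<and> runs R a x' z)"
      using assms(3) unfolding coloured_def locate by fastforce
  qed
  ultimately show ?thesis by blast
qed

lemma swap_step:
  assumes "in_simplex n (A @ (a, i) # (b, j) # B) G R" "balanced n (A @ (a, i) # (b, j) # B) G R"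
    "coloured n u (A @ (a, i) # (b, j) # B) G R" and ab: "(a, b) \<in> {(3, 1), (2, 3), (2, 1)}"
  shows "\<exists>G' R'. in_simplex n (A @ (b, j) # (a, i) # B) G' R' \<and> balanced n (A @ (b, j) # (a, i) # B) G' R' \<and>
    coloured n u (A @ (b, j) # (a, i) # B) G' R'"
proof -
  define p where "p = walk (start n) A"
  have p: "nat_vector n p" "nat_vector n (p + direction a)" "nat_vector n (p + direction a + direction b)"
    using assms(1) start_in_vertices unfolding in_simplex_def vertices_append p_def by auto
  obtain y c where c: "{a, b, c} = UNIV" "c \<noteq> a" "c \<noteq> b" and y: "down_cell n y" "nat_vector n (p + direction b)"
    and base: "base p a = (if a = 3 then y + e c else y + e a)"
    "base (p + direction a) b = (if b = 3 then y + e c else y + e b)"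
    "base p b = (if b = 3 then y + e b else y + e c)"
    "base (p + direction b) a = (if a = 3 then y + e a else y + e c)"
    using swap_geometry[OF ab p] .
  define old where "old = (\<lambda>l. if l = 3 then y + e c else y + e l)"
  define new where "new = (\<lambda>l. if l = 3 then y + e l else y + e c)"
  have comm: "p + direction b + direction a = p + direction a + direction b" by simp
  have locate: "locate (start n) (A @ (a, i) # (b, j) # B) =
      locate (start n) A @ (old a, a, i) # (old b, b, j) # locate (p + direction a + direction b) B"
    "locate (start n) (A @ (b, j) # (a, i) # B) =
      locate (start n) A @ (new b, b, j) # (new a, a, i) # locate (p + direction a + direction b) B"
    unfolding locate_append by (simp_all add: base comm old_def new_def flip: p_def)
  have "in_simplex n (A @ (b, j) # (a, i) # B) G ((y, c) # R)"
    using assms(1) p y unfolding in_simplex_def vertices_append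
    by (auto simp: comm simp flip: p_def)
  moreover have "balanced n (A @ (b, j) # (a, i) # B) G ((y, c) # R)"
    unfolding balanced_def
  proof (intro allI impI)
    fix z assume z: "up_cell n z"
    define hit where "hit = (\<lambda>l. if y + e l = z then 1 else 0 :: nat)"
    define S S' where "S = (\<lambda>l. count_list (sides n (A @ (a, i) # (b, j) # B)) (z, l))"
      and "S' = (\<lambda>l. count_list (sides n (A @ (b, j) # (a, i) # B)) (z, l))"
    define U U' where "U = count_list (ups G R) z" and "U' = count_list (ups G ((y, c) # R)) z"
    define D D' where "D = (\<lambda>l. count_list (map fst R) (z - e l))"
      and "D' = (\<lambda>l. count_list (map fst ((y, c) # R)) (z - e l))"
    have D': "D' l = hit l + D l" for l
      unfolding hit_def D_def D'_def by (auto simp: eq_diff_eq)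
    have U': "U' = hit c + U"
      unfolding ups_def hit_def U_def U'_def by simp
    have side: "S' l + (if l = a then hit (if l = 3 then c else l) else 0) +
        (if l = b then hit (if l = 3 then c else l) else 0) =
        S l + (if l = a then hit (if l = 3 then l else c) else 0) +
        (if l = b then hit (if l = 3 then l else c) else 0)" for l
      unfolding S_def S'_def sides_def locate old_def new_def hit_def by auto
    have balance: "S 3 + U = (if z $ 3 = 0 then 1 else 0) + D 3" "S 1 + D 1 = U" "S 2 + D 2 = U"
      using assms(2) z unfolding balanced_def S_def U_def D_def by blast+
    consider "a = 3" "b = 1" "c = 2" | "a = 2" "b = 3" "c = 1" | "a = 2" "b = 1" "c = 3"
      using ab c exhaust_3[of c] by auto
    then have "S' 3 + U' = (if z $ 3 = 0 then 1 else 0) + D' 3 \<and> S' 1 + D' 1 = U' \<and> S' 2 + D' 2 = U'"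
      by cases (use balance side[of 1] side[of 2] side[of 3] in \<open>simp_all add: D' U'\<close>)
    then show "count_list (sides n (A @ (b, j) # (a, i) # B)) (z, 3) + count_list (ups G ((y, c) # R)) z =
       (if z $ 3 = 0 then 1 else 0) + count_list (map fst ((y, c) # R)) (z - e 3) \<and>
     count_list (sides n (A @ (b, j) # (a, i) # B)) (z, 1) + count_list (map fst ((y, c) # R)) (z - e 1) =
       count_list (ups G ((y, c) # R)) z \<and>
     count_list (sides n (A @ (b, j) # (a, i) # B)) (z, 2) + count_list (map fst ((y, c) # R)) (z - e 2) =
       count_list (ups G ((y, c) # R)) z"
      unfolding S'_def U'_def D'_def .
  qed
  moreover have "coloured n u (A @ (b, j) # (a, i) # B) G ((y, c) # R)"
  proof -
    have run: "runs ((y, c) # R) l (y + e l) (y + e c)" if "c \<noteq> l" for l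
      unfolding runs_def using that by (intro r_into_rtranclp) (auto simp: crosses_def)
    show ?thesis unfolding coloured_def
  proof (intro conjI allI impI)
    have "a \<noteq> 3 \<or> b \<noteq> 3" using ab by auto
    then show "mset (map fst G) + mset (map snd (filter (\<lambda>x. fst x = 3) (A @ (b, j) # (a, i) # B))) = mset u"
      using assms(3) unfolding coloured_def by auto
  next
    fix k x assume "(k, x) \<in> set G \<or> (x, 3, k) \<in> set (locate (start n) (A @ (b, j) # (a, i) # B))"
    then obtain x' where x': "(k, x') \<in> set G \<or> (x', 3, k) \<in> set (locate (start n) (A @ (a, i) # (b, j) # B))"
      and *: "x' = x \<or> x' = old 3 \<and> x = new 3 \<and> c \<noteq> 3" unfolding locate using c by auto
    have "runs ((y, c) # R) 3 x x'"
    proof (cases "x' = x")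
      case False
      then have "c \<noteq> 3" using * by auto
      from run[OF this] show ?thesis using * False unfolding old_def new_def by simp
    qed (simp add: runs_def)
    moreover obtain z where z: "(z, 3, k) \<in> set (locate (start n) (map (Pair 3) u))" "runs R 3 x' z"
      using x' assms(3) unfolding coloured_def by blast
    ultimately have "runs ((y, c) # R) 3 x z" using runs_trans runs_Cons[OF z(2)] by blast
    then show "\<exists>z. (z, 3, k) \<in> set (locate (start n) (map (Pair 3) u)) \<and> runs ((y, c) # R) 3 x z"
      using z(1) by blast
  next
    fix l k z assume l: "l \<noteq> 3 \<and> (z, l, k) \<in> set (locate (start n) (A @ (b, j) # (a, i) # B))"
    then obtain z' where z': "(z', l, k) \<in> set (locate (start n) (A @ (a, i) # (b, j) # B))"
      and *: "z' = z \<or> z' = old l \<and> z = new l \<and> l \<noteq> c" unfolding locate using c by auto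
    have "runs ((y, c) # R) l z' z"
    proof (cases "z' = z")
      case False
      then have "c \<noteq> l" using * by auto
      from run[OF this] show ?thesis using * False l unfolding old_def new_def by simp
    qed (simp add: runs_def)
    moreover obtain x where x: "(k, x) \<in> set G" "runs R l x z'"
      using z' l assms(3) unfolding coloured_def by blast
    ultimately have "runs ((y, c) # R) l x z" using runs_trans runs_Cons[OF x(2)] by blast
    then show "\<exists>x. (k, x) \<in> set G \<and> runs ((y, c) # R) l x z"
      using x(1) by blast
    qed
  qed
  ultimately show ?thesis by blast
qed

lemma base_on_edges:
  "base (start n + real k *\<^sub>R direction 3) 3 = edge_cell n 2 1 k"
  "base (start n + real k *\<^sub>R direction 1) 1 = edge_cell n 2 3 k"
  "base (axis 3 (real n) + real k *\<^sub>R direction 2) 2 = edge_cell n 3 1 k"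
  by (simp_all add: vec_eq_iff forall_3 base_def direction_def edge_cell_def axis_component)

lemma edge_cell_swap: "k < n \<Longrightarrow> edge_cell n p q (n - Suc k) = edge_cell n q p k"
  by (simp add: edge_cell_def of_nat_diff add.commute diff_diff_eq)

lemma count_list_distinct: "distinct xs \<Longrightarrow> count_list xs x = (if x \<in> set xs then 1 else 0)"
  by (induction xs) auto

lemma count_edge_cells:
  assumes "{b. b \<noteq> a} = {p, q}" "p \<noteq> q" "up_cell n z"
  shows "count_list (map (edge_cell n p q) [0..<n]) z = (if z $ a = 0 then 1 else 0)"
proof -
  have "a \<noteq> p" "a \<noteq> q" using assms(1) by auto
  have UNIV: "UNIV = {a, p, q}" using assms(1) by auto
  have inj: "inj_on (edge_cell n p q) {0..<n}"
  proof (rule inj_onI)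
    fix k l assume "edge_cell n p q k = edge_cell n p q l"
    then have "edge_cell n p q k $ q = edge_cell n p q l $ q" by simp
    then show "k = l" using assms(2) by (simp add: edge_cell_def axis_component)
  qed
  have "(\<exists>k<n. z = edge_cell n p q k) \<longleftrightarrow> z $ a = 0"
  proof
    assume "\<exists>k<n. z = edge_cell n p q k"
    then show "z $ a = 0" using \<open>a \<noteq> p\<close> \<open>a \<noteq> q\<close> by (auto simp: edge_cell_def axis_component)
  next
    assume a: "z $ a = 0"
    have "(\<Sum>b\<in>UNIV. z $ b) = z $ a + (z $ p + z $ q)"
      unfolding UNIV using \<open>a \<noteq> p\<close> \<open>a \<noteq> q\<close> assms(2) by simp
    then have sum: "z $ p + z $ q = real n - 1" using assms(3) a unfolding up_cell_iff by simp
    have "z $ q \<in> \<nat>" "0 \<le> z $ p" using assms(3) unfolding up_cell_iff nats_iff by blast+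
    then obtain k where k: "z $ q = real k" by (auto elim: Nats_cases)
    have "z $ b = edge_cell n p q k $ b" for b
    proof -
      have "b = a \<or> b = p \<or> b = q" using UNIV by blast
      then show ?thesis using a k sum \<open>a \<noteq> p\<close> \<open>a \<noteq> q\<close> assms(2)
        by (auto simp: edge_cell_def axis_component)
    qed
    then have "z = edge_cell n p q k" by (simp add: vec_eq_iff)
    moreover have "k < n" using sum k \<open>0 \<le> z $ p\<close> by linarith
    ultimately show "\<exists>k<n. z = edge_cell n p q k" by blast
  qed
  moreover have "distinct (map (edge_cell n p q) [0..<n])" using inj by (simp add: distinct_map)
  ultimately show ?thesis by (auto simp: count_list_distinct)
qed

lemma count_list_pair: "count_list (map (\<lambda>k. (f k, a)) ks) (z, b) = (if a = b then count_list (map f ks) z else 0)"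
  by (induction ks) auto

lemma locate_edges:
  assumes "length u = n" "length w = n" "length v = n"
  shows "locate (start n) (map (Pair 3) u) = map (\<lambda>k. (edge_cell n 2 1 k, 3, u ! k)) [0..<n]"
    "locate (start n) (map (Pair 1) w @ map (Pair 2) v) =
      map (\<lambda>k. (edge_cell n 2 3 k, 1, w ! k)) [0..<n] @ map (\<lambda>k. (edge_cell n 3 1 k, 2, v ! k)) [0..<n]"
proof -
  have "start n + real n *\<^sub>R direction 1 = axis 3 (real n)"
    by (simp add: vec_eq_iff forall_3 direction_def axis_component)
  then show "locate (start n) (map (Pair 3) u) = map (\<lambda>k. (edge_cell n 2 1 k, 3, u ! k)) [0..<n]"
    "locate (start n) (map (Pair 1) w @ map (Pair 2) v) =
      map (\<lambda>k. (edge_cell n 2 3 k, 1, w ! k)) [0..<n] @ map (\<lambda>k. (edge_cell n 3 1 k, 2, v ! k)) [0..<n]"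
    using assms by (simp_all add: locate_append locate_monochrome walk_monochrome base_on_edges)
qed

text \<open>
As a set of segments, the path is the left edge at the beginning of a sweep and consists of the other two edges at
its end.
\<close>

lemma count_sides_edges:
  assumes "length u = n" "length w = n" "length v = n" "up_cell n z"
  shows "count_list (sides n (map (Pair 3) u)) (z, a) = (if a = 3 \<and> z $ 3 = 0 then 1 else 0)"
    "count_list (sides n (map (Pair 1) w @ map (Pair 2) v)) (z, a) = (if a \<noteq> 3 \<and> z $ a = 0 then 1 else 0)"
proof -
  have edges: "{b. b \<noteq> (1::3)} = {2, 3}" "{b. b \<noteq> (2::3)} = {3, 1}" "{b. b \<noteq> (3::3)} = {2, 1}"
    using exhaust_3 by auto
  note count = edges[THEN count_edge_cells, OF _ assms(4), simplified]
  show "count_list (sides n (map (Pair 3) u)) (z, a) = (if a = 3 \<and> z $ 3 = 0 then 1 else 0)"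
    unfolding sides_def locate_edges(1)[OF assms(1-3)] map_map o_def prod.case count_list_pair count by simp
  show "count_list (sides n (map (Pair 1) w @ map (Pair 2) v)) (z, a) = (if a \<noteq> 3 \<and> z $ a = 0 then 1 else 0)"
    unfolding sides_def locate_edges(2)[OF assms(1-3)] map_append map_map o_def prod.case
      count_list_append count_list_pair count using exhaust_3[of a] by auto
qed

lemma swept_states:
  assumes "sweep\<^sup>*\<^sup>* (map (Pair 3) u) W" "length u = n"
  shows "\<exists>G R. in_simplex n W G R \<and> balanced n W G R \<and> coloured n u W G R"
  using assms(1)
proof (induction rule: rtranclp_induct)
  case base
  have "in_simplex n (map (Pair 3) u) [] []"
    using assms(2) unfolding in_simplex_def vertices_monochrome
    by (auto simp: nat_vector_iff forall_3 direction_def axis_component)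
  moreover have "balanced n (map (Pair 3) u) [] []"
    unfolding balanced_def using count_sides_edges(1)[OF assms(2) assms(2) assms(2)] by (simp add: ups_def)
  moreover have "coloured n u (map (Pair 3) u) [] []"
    unfolding coloured_def
  proof (intro conjI allI impI)
    show "mset (map fst []) + mset (map snd (filter (\<lambda>x. fst x = 3) (map (Pair 3) u))) = mset u"
      by (simp add: filter_map o_def)
  next
    fix i x assume "(i, x) \<in> set [] \<or> (x, 3, i) \<in> set (locate (start n) (map (Pair 3) u))"
    then show "\<exists>z. (z, 3, i) \<in> set (locate (start n) (map (Pair 3) u)) \<and> runs [] 3 x z"
      unfolding runs_def by auto
  next
    fix a i z assume "a \<noteq> 3 \<and> (z, a, i) \<in> set (locate (start n) (map (Pair 3) u))"
    then show "\<exists>x. (i, x) \<in> set [] \<and> runs [] a x z"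
      unfolding locate_monochrome by auto
  qed
  ultimately show ?case by blast
next
  case (step W W')
  then obtain G R where inv: "in_simplex n W G R" "balanced n W G R" "coloured n u W G R" by blast
  from step(2) inv show ?case
  proof (cases rule: sweep.cases)
    case split
    show ?thesis using split_step inv unfolding split by blast
  next
    case swap
    show ?thesis using swap_step swap(3) inv unfolding swap(1,2) by blast
  qed
qed

lemma count_list_map_ge_two:
  assumes "x \<in> set xs" "y \<in> set xs" "x \<noteq> y" "f x = z" "f y = z"
  shows "2 \<le> count_list (map f xs) z"
  using assms
proof (induction xs)
  case (Cons a xs)
  have "1 \<le> count_list (map f xs) z" if "b \<in> set xs" "f b = z" for b
    using that count_list_0_iff[of "map f xs" z] by (force simp: Suc_le_eq)
  then show ?case using Cons by auto
qed simp

text \<open>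
The final path has no inner segments, so by \<open>balanced\<close> the multiplicities on the two sides of any inner segment
agree, and they are 1 along the bottom edge. An upward triangle off the bottom edge is connected to one in the
row below through the downward triangle under it.
\<close>

lemma swept_once:
  assumes "length w = n" "length v = n" "in_simplex n (map (Pair 1) w @ map (Pair 2) v) G R"
    and "balanced n (map (Pair 1) w @ map (Pair 2) v) G R"
  shows "up_cell n z \<Longrightarrow> count_list (ups G R) z = 1" "down_cell n y \<Longrightarrow> count_list (map fst R) y = 1"
proof -
  have balance: "count_list (ups G R) z = (if z $ 3 = 0 then 1 else 0) + count_list (map fst R) (z - e 3)"
    "(if z $ 1 = 0 then 1 else 0) + count_list (map fst R) (z - e 1) = count_list (ups G R) z"
    "(if z $ 2 = 0 then 1 else 0) + count_list (map fst R) (z - e 2) = count_list (ups G R) z"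
    if "up_cell n z" for z
    using assms(4) that count_sides_edges(2)[OF assms(1,1,2) that] unfolding balanced_def by auto
  have outside: "count_list (map fst R) (z - e a) = 0" if "z $ a = 0" for z a
  proof -
    have "\<not> down_cell n (z - e a)" using that unfolding down_cell_iff by (auto simp: axis_component intro!: exI[of _ a])
    then show ?thesis using assms(3) unfolding in_simplex_def by (auto simp: count_list_0_iff)
  qed
  have up: "count_list (ups G R) z = 1" if "up_cell n z" for z
  proof -
    have "z $ 1 \<in> \<nat>" using that unfolding up_cell_iff nats_iff by blast
    then obtain m where "z $ 1 = real m" by (auto elim: Nats_cases)
    then show ?thesis using that
    proof (induction m arbitrary: z)
      case 0
      then show ?case using balance(2) outside by fastforce
    next
      case (Suc m)
      let ?z = "z - e 1 + e 2"
      have z: "\<And>a. z $ a \<in> \<int>" "\<And>a. 0 \<le> z $ a" "z$1 + z$2 + z$3 = real n - 1"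
        using Suc(3) unfolding up_cell_iff sum_3 by blast+
      have "up_cell n ?z"
        unfolding up_cell_iff sum_3 forall_3 using z Suc(2) by (simp add: axis_component)
      moreover have "?z $ 1 = real m" "?z $ 2 \<noteq> 0"
        using Suc(2) z(2)[of 2] by (simp_all add: axis_component)
      ultimately show ?case
        using Suc(1)[of ?z] balance(2)[OF Suc(3)] balance(3)[of ?z] Suc(2) by simp
    qed
  qed
  then show "up_cell n z \<Longrightarrow> count_list (ups G R) z = 1" .
  assume "down_cell n y"
  then have "up_cell n (y + e 1)" "(y + e 1) $ 1 \<noteq> 0"
    using up_cell_above_down_cell unfolding down_cell_iff
    by (auto simp: axis_component add_nonneg_eq_0_iff)
  then show "count_list (map fst R) y = 1" using balance(2) up by force
qed

section \<open>The tiling realizing an acyclic system\<close>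

definition swept_tiles :: "(nat \<times> (real ^ 3)) list \<Rightarrow> ((real ^ 3) \<times> 3) list \<Rightarrow> (real ^ 3) set set" where
  "swept_tiles G R = (\<lambda>(i, x). up_triangle x) ` set G \<union>
     (\<lambda>(y, b). up_triangle (y + e b) \<union> down_triangle y) ` set R"

text \<open>
What \<open>swept_once\<close> provides at the end of a sweep.
\<close>

locale single_cover =
  fixes n :: nat and G :: "(nat \<times> (real ^ 3)) list" and R :: "((real ^ 3) \<times> 3) list"
  assumes cells: "\<And>i x. (i, x) \<in> set G \<Longrightarrow> up_cell n x" "\<And>y b. (y, b) \<in> set R \<Longrightarrow> down_cell n y"
    and once: "\<And>z. up_cell n z \<Longrightarrow> count_list (ups G R) z = 1"
      "\<And>y. down_cell n y \<Longrightarrow> count_list (map fst R) y = 1"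
begin

lemma swept_tiles_cases:
  assumes "S \<in> swept_tiles G R"
  obtains i x where "(i, x) \<in> set G" "S = up_triangle x"
  | y b where "(y, b) \<in> set R" "S = up_triangle (y + e b) \<union> down_triangle y"
  using assms unfolding swept_tiles_def by auto

lemma swept_triangle_unique: "(i, x) \<in> set G \<Longrightarrow> (j, x) \<in> set G \<Longrightarrow> i = j"
  using count_list_map_ge_two[of "(i, x)" G "(j, x)" snd x] once(1)[of x] cells(1)[of i x]
  unfolding ups_def by fastforce

lemma swept_up_unique:
  assumes "(y, b) \<in> set R" "(y', b') \<in> set R" "y + e b = y' + e b'"
  shows "(y, b) = (y', b')"
  using count_list_map_ge_two[of "(y, b)" R "(y', b')" "\<lambda>(y, b). y + e b" "y + e b"] assms
    once(1)[OF up_cell_above_down_cell[OF cells(2)[OF assms(1)]], of b]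
  unfolding ups_def by fastforce

lemma swept_up_separate:
  assumes "(i, x) \<in> set G" "(y, b) \<in> set R" shows "x \<noteq> y + e b"
proof
  assume "x = y + e b"
  then have "x \<in> set (map snd G)" "x \<in> set (map (\<lambda>(y, b). y + e b) R)" using assms by force+
  then have "count_list (map snd G) x \<noteq> 0" "count_list (map (\<lambda>(y, b). y + e b) R) x \<noteq> 0"
    unfolding count_list_0_iff by blast+
  then show False using once(1)[OF cells(1)[OF assms(1)]] unfolding ups_def by simp
qed

lemma swept_down_unique: "(y, b) \<in> set R \<Longrightarrow> (y, b') \<in> set R \<Longrightarrow> b = b'"
  using count_list_map_ge_two[of "(y, b)" R "(y, b')" fst y] once(2)[of y] cells(2)[of y b]
  by fastforce

lemma swept_tile_of_up:
  assumes "up_cell n z" "S \<in> swept_tiles G R" "up_triangle z \<subseteq> S"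
  shows "(\<exists>i. (i, z) \<in> set G \<and> S = up_triangle z) \<or>
    (\<exists>y b. (y, b) \<in> set R \<and> z = y + e b \<and> S = up_triangle (y + e b) \<union> down_triangle y)"
proof -
  have unit: "unit_triangle n (up_triangle z)" using assms(1) unfolding unit_triangle_def by blast
  show ?thesis using assms(2)
  proof (cases rule: swept_tiles_cases)
    case (1 i x)
    then have "up_triangle z = up_triangle x"
      using unit_triangle_in_up_triangle[OF unit] cells(1) assms(3) by metis
    then show ?thesis using 1 up_triangle_inject by metis
  next
    case (2 y b)
    then have "down_cell n y" using cells(2) by blast
    then have "up_triangle z = up_triangle (y + e b)"
      using unit_triangle_in_rhombus[OF unit, of y b] assms(1,3) up_triangle_neq_down_triangle 2(2) by metis
    then show ?thesis using 2 up_triangle_inject by metis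
  qed
qed

lemma swept_tile_of_down:
  assumes "down_cell n y" "S \<in> swept_tiles G R" "down_triangle y \<subseteq> S"
  shows "\<exists>b. (y, b) \<in> set R \<and> S = up_triangle (y + e b) \<union> down_triangle y"
proof -
  have unit: "unit_triangle n (down_triangle y)" using assms(1) unfolding unit_triangle_def by blast
  show ?thesis using assms(2)
  proof (cases rule: swept_tiles_cases)
    case (1 i x)
    then show ?thesis
      using unit_triangle_in_up_triangle[OF unit] up_triangle_neq_down_triangle cells(1) assms(1,3) by metis
  next
    case (2 y' b)
    then have "down_cell n y'" using cells(2) by blast
    then have "down_triangle y = down_triangle y'"
      using unit_triangle_in_rhombus[OF unit, of y' b] assms(1,3) up_triangle_neq_down_triangle
        up_cell_above_down_cell 2(2) by metis
    then have "y = y'" using down_triangle_inject assms(1) \<open>down_cell n y'\<close> by blast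
    then show ?thesis using 2 by blast
  qed
qed

lemma lozenge_tiling_swept_tiles:
  assumes "n \<ge> 1" shows "lozenge_tiling n (swept_tiles G R)"
  unfolding lozenge_tiling_iff[OF assms]
proof (intro conjI allI impI)
  show "swept_tiles G R \<subseteq> tiles n"
  proof
    fix S assume "S \<in> swept_tiles G R"
    then show "S \<in> tiles n"
      by (cases rule: swept_tiles_cases)
        (use cells up_triangle_tile rhombus_tile in \<open>auto simp: tiles_def\<close>)
  qed
next
  fix U assume "unit_triangle n U"
  then consider z where "up_cell n z" "U = up_triangle z" | y where "down_cell n y" "U = down_triangle y"
    unfolding unit_triangle_def by blast
  then show "\<exists>!S. S \<in> swept_tiles G R \<and> U \<subseteq> S"
  proof cases
    case 1
    have "count_list (ups G R) z \<noteq> 0" using once(1)[OF 1(1)] by simp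
    then have "z \<in> set (ups G R)" unfolding count_list_0_iff by blast
    then have "\<exists>S. S \<in> swept_tiles G R \<and> U \<subseteq> S"
      unfolding ups_def swept_tiles_def 1(2) by fastforce
    moreover have "S = S'" if S: "S \<in> swept_tiles G R" "U \<subseteq> S" "S' \<in> swept_tiles G R" "U \<subseteq> S'" for S S'
      using swept_tile_of_up[OF 1(1) S(1) S(2)[unfolded 1(2)]]
    proof (elim disjE exE conjE)
      fix i assume "(i, z) \<in> set G" "S = up_triangle z"
      then show ?thesis
        using swept_tile_of_up[OF 1(1) S(3) S(4)[unfolded 1(2)]] swept_up_separate by blast
    next
      fix y b assume yb: "(y, b) \<in> set R" "z = y + e b" "S = up_triangle (y + e b) \<union> down_triangle y"
      then obtain y' b' where "(y', b') \<in> set R" "z = y' + e b'"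
        "S' = up_triangle (y' + e b') \<union> down_triangle y'"
        using swept_tile_of_up[OF 1(1) S(3) S(4)[unfolded 1(2)]] swept_up_separate by blast
      then show ?thesis using yb swept_up_unique[of y b y' b'] by simp
    qed
    ultimately show ?thesis by (intro ex_ex1I) simp_all
  next
    case 2
    have "count_list (map fst R) y \<noteq> 0" using once(2)[OF 2(1)] by simp
    then have "y \<in> set (map fst R)" unfolding count_list_0_iff by blast
    then have "\<exists>S. S \<in> swept_tiles G R \<and> U \<subseteq> S"
      unfolding swept_tiles_def 2(2) by fastforce
    moreover have "S = S'" if S: "S \<in> swept_tiles G R" "U \<subseteq> S" "S' \<in> swept_tiles G R" "U \<subseteq> S'" for S S'
    proof -
      obtain b b' where "(y, b) \<in> set R" "S = up_triangle (y + e b) \<union> down_triangle y"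
        "(y, b') \<in> set R" "S' = up_triangle (y + e b') \<union> down_triangle y"
        using swept_tile_of_down[OF 2(1) S(1) S(2)[unfolded 2(2)]]
          swept_tile_of_down[OF 2(1) S(3) S(4)[unfolded 2(2)]] by blast
      then show ?thesis using swept_down_unique by blast
    qed
    ultimately show ?thesis by (intro ex_ex1I) simp_all
  qed
qed

lemma swept_tiles_triangles: "swept_tiles G R \<inter> up_triangles n = (\<lambda>(i, x). up_triangle x) ` set G"
proof (intro subset_antisym subsetI)
  fix S assume S: "S \<in> swept_tiles G R \<inter> up_triangles n"
  then obtain x where x: "up_cell n x" "S = up_triangle x"
    unfolding up_triangles_def up_cell_def by blast
  from S have "S \<in> swept_tiles G R" ..
  then show "S \<in> (\<lambda>(i, x). up_triangle x) ` set G"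
  proof (cases rule: swept_tiles_cases)
    case (2 y b)
    then have y: "down_cell n y" using cells(2) by blast
    then have "unit_triangle n (down_triangle y)" unfolding unit_triangle_def by blast
    from unit_triangle_in_up_triangle[OF this x(1)] have "down_triangle y = up_triangle x"
      using 2(2) x(2) by blast
    then show ?thesis using up_triangle_neq_down_triangle[OF x(1) y] by simp
  qed force
next
  fix S assume "S \<in> (\<lambda>(i, x). up_triangle x) ` set G"
  then show "S \<in> swept_tiles G R \<inter> up_triangles n"
    using cells(1) up_triangle_tile unfolding swept_tiles_def by auto
qed

lemma runs_imp_spreads:
  assumes "runs R a x z" shows "spreads n (swept_tiles G R) (up_triangle x) (up_side z a)"
proof -
  have "(\<lambda>s s'. \<exists>S\<in>swept_tiles G R. opposite_sides n S s s')\<^sup>*\<^sup>* (up_side x a) (up_side z a)"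
    using assms unfolding runs_def
  proof (induction rule: rtranclp_induct)
    case (step z z')
    have "\<exists>S\<in>swept_tiles G R. opposite_sides n S (up_side z a) (up_side z' a)"
      using step(2) by (rule crosses_imp_spread) (use cells(2) in \<open>force simp: swept_tiles_def\<close>)
    then show ?case using step(3) by (rule rtranclp.rtrancl_into_rtrancl[rotated])
  qed simp
  then show ?thesis unfolding spreads_def by blast
qed

end

lemma tiling_if_acyclic:
  assumes "n \<ge> 1" and u: "u \<in> permutations_of_set {1..n}" and v: "v \<in> permutations_of_set {1..n}"
    and w: "w \<in> permutations_of_set {1..n}" and acyclic: "acyclic_system n u v w"
  shows "\<exists>T c. lozenge_tiling n T \<and> numbering n T c \<and> system_of_permutations n T c u v w"
proof -
  have len: "length u = n" "length v = n" "length w = n"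
    using u v w length_finite_permutations_of_set by fastforce+
  note perms = permutations_of_setD[OF u] permutations_of_setD[OF v] permutations_of_setD[OF w]
  let ?W = "map (Pair 1) (rev w) @ map (Pair 2) (rev v)"
  obtain G R where inv: "in_simplex n ?W G R" "balanced n ?W G R" "coloured n u ?W G R"
    using swept_states[OF sweep_if_acyclic[OF u v w acyclic] len(1)] by blast
  interpret single_cover n G R
  proof
    show "(i, x) \<in> set G \<Longrightarrow> up_cell n x" "(y, b) \<in> set R \<Longrightarrow> down_cell n y" for i x y b
      using inv(1) unfolding in_simplex_def by blast+
    show "up_cell n z \<Longrightarrow> count_list (ups G R) z = 1" "down_cell n y \<Longrightarrow> count_list (map fst R) y = 1" for y z
      using swept_once[OF _ _ inv(1,2)] len by simp_all
  qed
  let ?T = "swept_tiles G R"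
  define c where "c = (\<lambda>i. up_triangle (the (map_of G i)))"
  have "mset (map fst G) = mset u" using inv(3) unfolding coloured_def by (simp add: filter_map o_def)
  then have G: "distinct (map fst G)" "fst ` set G = {1..n}"
    using perms(1,2) by (metis mset_eq_imp_distinct_iff, metis mset_eq_setD set_map)
  have c: "c i = up_triangle x" if "(i, x) \<in> set G" for i x
    using that G(1) unfolding c_def by simp
  have triangle_of: "\<exists>x. (i, x) \<in> set G" if "i \<in> {1..n}" for i
    using that unfolding G(2)[symmetric] by auto
  have "numbering n ?T c"
    unfolding numbering_def swept_tiles_triangles
  proof (rule bij_betwI')
    fix i j assume "i \<in> {1..n}" "j \<in> {1..n}"
    then obtain x x' where x: "(i, x) \<in> set G" "(j, x') \<in> set G" using triangle_of by blast
    show "c i = c j \<longleftrightarrow> i = j"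
    proof
      assume "c i = c j"
      then have "x = x'" unfolding c[OF x(1)] c[OF x(2)] up_triangle_inject .
      then show "i = j" using swept_triangle_unique x by blast
    qed simp
  next
    fix i assume "i \<in> {1..n}"
    then obtain x where "(i, x) \<in> set G" using triangle_of by blast
    then show "c i \<in> (\<lambda>(i, x). up_triangle x) ` set G" using c by force
  next
    fix S assume "S \<in> (\<lambda>(i, x). up_triangle x) ` set G"
    then obtain i x where "(i, x) \<in> set G" "S = up_triangle x" by auto
    moreover from this have "i \<in> {1..n}" unfolding G(2)[symmetric] by force
    ultimately show "\<exists>i\<in>{1..n}. S = c i" using c by blast
  qed
  moreover have "edge_reading n ?T c 2 1 u"
    unfolding edge_reading_def edge_segment_eq_up_side[OF other_labels(3)]
  proof (intro conjI allI impI u)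
    fix k assume k: "k < n"
    then have "u ! k \<in> {1..n}" using perms(1) len(1) nth_mem by metis
    then obtain x where x: "(u ! k, x) \<in> set G" using triangle_of by blast
    then obtain z where z: "(z, 3, u ! k) \<in> set (locate (start n) (map (Pair 3) u))" "runs R 3 x z"
      using inv(3) unfolding coloured_def by blast
    then obtain k' where "k' < n" "z = edge_cell n 2 1 k'" "u ! k' = u ! k"
      unfolding locate_edges(1)[OF len(1) len(3) len(2)] by auto
    then have "z = edge_cell n 2 1 k" using k perms(2) len(1) by (simp add: nth_eq_iff_index_eq)
    then show "spreads n ?T (c (u ! k)) (up_side (edge_cell n 2 1 k) 3)"
      using runs_imp_spreads z(2) c[OF x] by simp
  qed
  moreover have final: "spreads n ?T (c i) (up_side z a)"
    if located: "(z, a, i) \<in> set (locate (start n) ?W)" "a \<noteq> 3" for z a i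
  proof -
    obtain x where "(i, x) \<in> set G" "runs R a x z" using inv(3) located unfolding coloured_def by blast
    then show ?thesis using runs_imp_spreads c by simp
  qed
  have final_edges: "locate (start n) ?W = map (\<lambda>k. (edge_cell n 2 3 k, 1, rev w ! k)) [0..<n] @
      map (\<lambda>k. (edge_cell n 3 1 k, 2, rev v ! k)) [0..<n]"
    using len by (intro locate_edges(2)[of u]) simp_all
  have "edge_reading n ?T c 1 3 v"
    unfolding edge_reading_def edge_segment_eq_up_side[OF other_labels(2)]
  proof (intro conjI allI impI v)
    fix k assume k: "k < n"
    then have "(edge_cell n 3 1 (n - Suc k), 2, rev v ! (n - Suc k)) \<in> set (locate (start n) ?W)"
      unfolding final_edges by auto
    then have "(edge_cell n 1 3 k, 2, v ! k) \<in> set (locate (start n) ?W)"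
      using k len by (simp add: edge_cell_swap rev_nth)
    then show "spreads n ?T (c (v ! k)) (up_side (edge_cell n 1 3 k) 2)" using final by simp
  qed
  moreover have "edge_reading n ?T c 3 2 w"
    unfolding edge_reading_def edge_segment_eq_up_side[OF other_labels(1)]
  proof (intro conjI allI impI w)
    fix k assume k: "k < n"
    then have "(edge_cell n 2 3 (n - Suc k), 1, rev w ! (n - Suc k)) \<in> set (locate (start n) ?W)"
      unfolding final_edges by auto
    then have "(edge_cell n 3 2 k, 1, w ! k) \<in> set (locate (start n) ?W)"
      using k len by (simp add: edge_cell_swap rev_nth)
    then show "spreads n ?T (c (w ! k)) (up_side (edge_cell n 3 2 k) 1)" using final by simp
  qed
  ultimately show ?thesis using lozenge_tiling_swept_tiles assms(1) unfolding system_of_permutations_def by blast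
qed

theorem theorem4p2:
  fixes n :: nat and u v w :: "nat list"
  assumes "n \<ge> 1"
    and "u \<in> permutations_of_set {1..n}"
    and "v \<in> permutations_of_set {1..n}"
    and "w \<in> permutations_of_set {1..n}"
  shows "(\<exists>T c. lozenge_tiling n T \<and> numbering n T c \<and> system_of_permutations n T c u v w)
    \<longleftrightarrow> acyclic_system n u v w"
  using acyclic_if_tiling tiling_if_acyclic assms by blast

end
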